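(* Let $G$ be a Lie group with Lie algebra $\mathfrak g$. The Lie–Poisson structure on $\mathfrak g_2^*\times\mathfrak g_3^*\ni(\mu,\nu)$, the dual of the Lie algebra $\mathfrak g\circledS\mathfrak g$ of $G\circledS\mathfrak g$, is given by the bracket $$\{F,K\}(\mu,\nu)=\Big\langle\mu,\Big[\frac{\delta F}{\delta\mu},\frac{\delta K}{\delta\mu}\Big]\Big\rangle+\Big\langle\nu,\Big[\frac{\delta F}{\delta\mu},\frac{\delta K}{\delta\nu}\Big]-\Big[\frac{\delta K}{\delta\mu},\frac{\delta F}{\delta\nu}\Big]\Big\rangle,$$ and Hamilton's equations for a function $H(\mu,\nu)$ read $$\frac{d\mu}{dt}=ad^*_{\frac{\delta H}{\delta\mu}}\mu+ad^*_{\frac{\delta H}{\delta\nu}}\nu,\qquad \frac{d\nu}{dt}=ad^*_{\frac{\delta H}{\delta\mu}}\nu.$$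
   Context: Conventions. $G$ is a (finite-dimensional) Lie group, $\mathfrak g=T_eG$, $\mathfrak g^*$ its dual, $\mathfrak g^{**}=\mathfrak g$; subscripts on copies of $\mathfrak g^*$ are only labels. $Ad_g$ is the tangent map at $e$ of $h\mapsto g^{-1}hg$; the Lie bracket is $[\xi,\eta]=ad_\xi\eta=\frac{d}{dt}|_{t=0}Ad_{\exp(t\xi)}\eta$ (the bracket of right invariant vector fields). $ad^*_\xi$ is defined by $\langle ad^*_\xi\mu,\eta\rangle=\langle\mu,[\xi,\eta]\rangle$. $G\circledS\mathfrak g$ is $G\times\mathfrak g$ with multiplication $(g,\xi)(h,\eta)=(gh,\xi+Ad_{g^{-1}}\eta)$; its Lie algebra $\mathfrak g\circledS\mathfrak g$ has bracket $[(\xi_1,\xi_2),(\eta_1,\eta_2)]=([\xi_1,\eta_1],[\xi_1,\eta_2]-[\eta_1,\xi_2])$. For a Lie algebra $\mathfrak k$ the Lie–Poisson bracket on $\mathfrak k^*$ is $\{F,K\}(\alpha)=\langle\alpha,[\delta F/\delta\alpha,\delta K/\delta\alpha]_{\mathfrak k}\rangle$, and the Hamiltonian vector field $X_H$ is defined by $\{F,H\}=-\langle dF,X_H\rangle$ for all $F$; Hamilton's equations are those of its integral curves. *)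

theory Defs
  imports "HOL-Analysis.Analysis" "HOL-Algebra.Group"
begin

section \<open>Smooth maps and smooth manifolds\<close>

text \<open>
  Only meant for open \<open>S\<close>: a map is \<open>C\<^sup>k\<^sup>+\<^sup>1\<close> iff it is differentiable and all
  its directional derivatives are \<open>C\<^sup>k\<close> (the domain is finite-dimensional in every use).
\<close>

primrec Ck_on :: "nat \<Rightarrow> ('a::real_normed_vector \<Rightarrow> 'b::real_normed_vector) \<Rightarrow> 'a set \<Rightarrow> bool" where
  "Ck_on 0 f S \<longleftrightarrow> continuous_on S f"
| "Ck_on (Suc k) f S \<longleftrightarrow>
     (\<forall>x\<in>S. f differentiable (at x)) \<and> (\<forall>v. Ck_on k (\<lambda>x. frechet_derivative f (at x) v) S)"

definition smooth_on :: "'a set \<Rightarrow> ('a::real_normed_vector \<Rightarrow> 'b::real_normed_vector) \<Rightarrow> bool" where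
  "smooth_on S f \<longleftrightarrow> (\<forall>k. Ck_on k f S)"

text \<open>
  A chart is a pair of its domain and its coordinate map (whose values off the domain are
  irrelevant). The model space \<open>'e\<close> is any finite-dimensional normed space, so that dimension
  \<open>0\<close> is not excluded; \<open>banach\<close> is no restriction in finite dimension.
\<close>

type_synonym ('m, 'e) chart = "'m set \<times> ('m \<Rightarrow> 'e)"

definition chart_inv :: "('m, 'e) chart \<Rightarrow> 'e \<Rightarrow> 'm" where
  "chart_inv c = inv_into (fst c) (snd c)"

definition smooth_manifold :: "'m topology \<Rightarrow> ('m, 'e::banach) chart set \<Rightarrow> bool" where
  "smooth_manifold X A \<longleftrightarrow>
     (\<exists>B::'e set. finite B \<and> span B = UNIV) \<and>
     Hausdorff_space X \<and> second_countable X \<and>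
     \<Union>(fst ` A) = topspace X \<and>
     (\<forall>(U, \<phi>)\<in>A. openin X U \<and> open (\<phi> ` U) \<and>
        homeomorphic_map (subtopology X U) (top_of_set (\<phi> ` U)) \<phi>) \<and>
     (\<forall>(U, \<phi>)\<in>A. \<forall>(V, \<psi>)\<in>A. smooth_on (\<phi> ` (U \<inter> V)) (\<psi> \<circ> chart_inv (U, \<phi>)))"

definition smooth_map ::
  "'m topology \<Rightarrow> ('m, 'e::banach) chart set \<Rightarrow> 'n topology \<Rightarrow> ('n, 'f::banach) chart set
    \<Rightarrow> ('m \<Rightarrow> 'n) \<Rightarrow> bool" where
  "smooth_map X A Y B f \<longleftrightarrow> continuous_map X Y f \<and>
     (\<forall>(U, \<phi>)\<in>A. \<forall>(V, \<psi>)\<in>B. smooth_on (\<phi> ` (U \<inter> f -` V)) (\<psi> \<circ> f \<circ> chart_inv (U, \<phi>)))"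

definition prod_chart :: "('m, 'e) chart \<Rightarrow> ('n, 'f) chart \<Rightarrow> ('m \<times> 'n, 'e \<times> 'f) chart" where
  "prod_chart c d = (fst c \<times> fst d, map_prod (snd c) (snd d))"

definition prod_atlas ::
  "('m, 'e) chart set \<Rightarrow> ('n, 'f) chart set \<Rightarrow> ('m \<times> 'n, 'e \<times> 'f) chart set" where
  "prod_atlas A B = {prod_chart c d | c d. c \<in> A \<and> d \<in> B}"

section \<open>Lie groups and their Lie algebras\<close>

record ('g, 'e) lie_grp = "'g monoid" +
  topol :: "'g topology"
  atlas :: "('g, 'e) chart set"

definition lie_group :: "('g, 'e::banach) lie_grp \<Rightarrow> bool" where
  "lie_group G \<longleftrightarrow>
     group G \<and> topspace (topol G) = carrier G \<and> smooth_manifold (topol G) (atlas G) \<and>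
     smooth_map (prod_topology (topol G) (topol G)) (prod_atlas (atlas G) (atlas G))
       (topol G) (atlas G) (\<lambda>(g, h). g \<otimes>\<^bsub>G\<^esub> h) \<and>
     smooth_map (topol G) (atlas G) (topol G) (atlas G) (\<lambda>g. m_inv G g)"

text \<open>
  The tangent space at the identity is identified with the model space \<open>'e\<close> through the
  differential of a chart \<open>c\<close> around the identity. All notions below are therefore relative
  to such a chart; a different choice only changes the coordinates on the Lie algebra.
\<close>

definition chart_at_one :: "('g, 'e) lie_grp \<Rightarrow> ('g, 'e) chart \<Rightarrow> bool" where
  "chart_at_one G c \<longleftrightarrow> c \<in> atlas G \<and> \<one>\<^bsub>G\<^esub> \<in> fst c"

text \<open>\<open>Ad\<^sub>g\<close> is the tangent map at the identity of \<open>h \<mapsto> g\<^sup>-\<^sup>1 h g\<close> (note the order).\<close>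

definition Ad :: "('g, 'e::real_normed_vector) lie_grp \<Rightarrow> ('g, 'e) chart \<Rightarrow> 'g \<Rightarrow> 'e \<Rightarrow> 'e" where
  "Ad G c g =
     frechet_derivative (\<lambda>x. snd c (m_inv G g \<otimes>\<^bsub>G\<^esub> chart_inv c x \<otimes>\<^bsub>G\<^esub> g)) (at (snd c \<one>\<^bsub>G\<^esub>))"

text \<open>
  Continuous homomorphisms between Lie groups are smooth, so these are the usual
  one-parameter subgroups.
\<close>

definition one_parameter_subgroup ::
  "('g, 'e::real_normed_vector) lie_grp \<Rightarrow> ('g, 'e) chart \<Rightarrow> 'e \<Rightarrow> (real \<Rightarrow> 'g) \<Rightarrow> bool" where
  "one_parameter_subgroup G c \<xi> \<gamma> \<longleftrightarrow>
     (\<forall>t. \<gamma> t \<in> carrier G) \<and> (\<forall>s t. \<gamma> (s + t) = \<gamma> s \<otimes>\<^bsub>G\<^esub> \<gamma> t) \<and>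
     continuous_map euclideanreal (topol G) \<gamma> \<and>
     ((\<lambda>t. snd c (\<gamma> t)) has_vector_derivative \<xi>) (at 0)"

definition lie_exp :: "('g, 'e::real_normed_vector) lie_grp \<Rightarrow> ('g, 'e) chart \<Rightarrow> 'e \<Rightarrow> 'g" where
  "lie_exp G c \<xi> = (THE \<gamma>. one_parameter_subgroup G c \<xi> \<gamma>) 1"

definition lie_bracket ::
  "('g, 'e::real_normed_vector) lie_grp \<Rightarrow> ('g, 'e) chart \<Rightarrow> 'e \<Rightarrow> 'e \<Rightarrow> 'e" where
  "lie_bracket G c \<xi> \<eta> = vector_derivative (\<lambda>t. Ad G c (lie_exp G c (t *\<^sub>R \<xi>)) \<eta>) (at 0)"

text \<open>The group \<open>G \<circledS> \<gg>\<close> and its chart at the identity induced by \<open>c\<close>.\<close>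

definition semidirect ::
  "('g, 'e::real_normed_vector) lie_grp \<Rightarrow> ('g, 'e) chart \<Rightarrow> ('g \<times> 'e, 'e \<times> 'e) lie_grp" where
  "semidirect G c =
     \<lparr>carrier = carrier G \<times> UNIV,
      mult = (\<lambda>(g, \<xi>) (h, \<eta>). (g \<otimes>\<^bsub>G\<^esub> h, \<xi> + Ad G c (m_inv G g) \<eta>)),
      one = (\<one>\<^bsub>G\<^esub>, 0),
      topol = prod_topology (topol G) euclidean,
      atlas = prod_atlas (atlas G) {(UNIV, id)}\<rparr>"

definition semidirect_chart :: "('g, 'e) chart \<Rightarrow> ('g \<times> 'e, 'e \<times> 'e) chart" where
  "semidirect_chart c = prod_chart c (UNIV, id)"

section \<open>Lie--Poisson structures\<close>

text \<open>
  The dual of a finite-dimensional space \<open>'k\<close> is the type \<open>'k \<Rightarrow>\<^sub>L real\<close>. The functional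
  derivative lies in the bidual, which is identified with \<open>'k\<close>.
\<close>

definition functional_derivative ::
  "(('k::real_normed_vector \<Rightarrow>\<^sub>L real) \<Rightarrow> real) \<Rightarrow> ('k \<Rightarrow>\<^sub>L real) \<Rightarrow> 'k" where
  "functional_derivative F \<alpha> =
     (THE \<xi>. \<forall>\<beta>. frechet_derivative F (at \<alpha>) \<beta> = blinfun_apply \<beta> \<xi>)"

definition lie_poisson ::
  "('k::real_normed_vector \<Rightarrow> 'k \<Rightarrow> 'k) \<Rightarrow> (('k \<Rightarrow>\<^sub>L real) \<Rightarrow> real) \<Rightarrow> (('k \<Rightarrow>\<^sub>L real) \<Rightarrow> real)
    \<Rightarrow> ('k \<Rightarrow>\<^sub>L real) \<Rightarrow> real" where
  "lie_poisson br F K \<alpha> =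
     blinfun_apply \<alpha> (br (functional_derivative F \<alpha>) (functional_derivative K \<alpha>))"

definition hamiltonian_vector_field ::
  "('k::real_normed_vector \<Rightarrow> 'k \<Rightarrow> 'k) \<Rightarrow> (('k \<Rightarrow>\<^sub>L real) \<Rightarrow> real)
    \<Rightarrow> (('k \<Rightarrow>\<^sub>L real) \<Rightarrow> ('k \<Rightarrow>\<^sub>L real)) \<Rightarrow> bool" where
  "hamiltonian_vector_field br H X \<longleftrightarrow>
     (\<forall>F. smooth_on UNIV F \<longrightarrow>
        (\<forall>\<alpha>. lie_poisson br F H \<alpha> = - frechet_derivative F (at \<alpha>) (X \<alpha>)))"

definition integral_curve :: "('v::real_normed_vector \<Rightarrow> 'v) \<Rightarrow> real set \<Rightarrow> (real \<Rightarrow> 'v) \<Rightarrow> bool" where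
  "integral_curve X T c \<longleftrightarrow> (\<forall>t\<in>T. (c has_vector_derivative X (c t)) (at t))"

definition ad_star ::
  "('k::real_normed_vector \<Rightarrow> 'k \<Rightarrow> 'k) \<Rightarrow> 'k \<Rightarrow> ('k \<Rightarrow>\<^sub>L real) \<Rightarrow> ('k \<Rightarrow>\<^sub>L real)" where
  "ad_star br \<xi> \<mu> = Blinfun (\<lambda>\<eta>. blinfun_apply \<mu> (br \<xi> \<eta>))"

text \<open>
  The identification of \<open>\<gg>\<^sup>* \<times> \<gg>\<^sup>*\<close> with \<open>(\<gg> \<times> \<gg>)\<^sup>*\<close>, and its inverse.
\<close>

definition dual_pair ::
  "('a::real_normed_vector \<Rightarrow>\<^sub>L real) \<times> ('b::real_normed_vector \<Rightarrow>\<^sub>L real) \<Rightarrow> ('a \<times> 'b) \<Rightarrow>\<^sub>L real" where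
  "dual_pair p = (fst p o\<^sub>L fst_blinfun) + (snd p o\<^sub>L snd_blinfun)"

definition dual_split ::
  "('a::real_normed_vector \<times> 'b::real_normed_vector) \<Rightarrow>\<^sub>L real \<Rightarrow> ('a \<Rightarrow>\<^sub>L real) \<times> ('b \<Rightarrow>\<^sub>L real)" where
  "dual_split \<alpha> = (Blinfun (\<lambda>x. blinfun_apply \<alpha> (x, 0)), Blinfun (\<lambda>y. blinfun_apply \<alpha> (0, y)))"

lemma dual_pair_apply:
  "blinfun_apply (dual_pair (\<mu>, \<nu>)) (x, y) = blinfun_apply \<mu> x + blinfun_apply \<nu> y"
  by (simp add: dual_pair_def blinfun.add_left)

lemma blinfun_apply_dual_split:
  "blinfun_apply (fst (dual_split \<alpha>)) x = blinfun_apply \<alpha> (x, 0)"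
  "blinfun_apply (snd (dual_split \<alpha>)) y = blinfun_apply \<alpha> (0, y)"
proof -
  have "bounded_linear (\<lambda>x. blinfun_apply \<alpha> (x, 0))"
    by (intro bounded_linear_intros bounded_linear_Pair bounded_linear_ident bounded_linear_zero)
  moreover have "bounded_linear (\<lambda>y. blinfun_apply \<alpha> (0, y))"
    by (intro bounded_linear_intros bounded_linear_Pair bounded_linear_ident bounded_linear_zero)
  ultimately show "blinfun_apply (fst (dual_split \<alpha>)) x = blinfun_apply \<alpha> (x, 0)"
    "blinfun_apply (snd (dual_split \<alpha>)) y = blinfun_apply \<alpha> (0, y)"
    by (simp_all add: dual_split_def bounded_linear_Blinfun_apply)
qed

lemma dual_split_dual_pair: "dual_split (dual_pair p) = p"
  by (cases p) (auto intro!: prod_eqI blinfun_eqI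
      simp: blinfun_apply_dual_split dual_pair_apply)

lemma dual_pair_dual_split: "dual_pair (dual_split \<alpha>) = \<alpha>"
proof (rule blinfun_eqI)
  fix z
  show "blinfun_apply (dual_pair (dual_split \<alpha>)) z = blinfun_apply \<alpha> z"
    using dual_pair_apply[of "fst (dual_split \<alpha>)" "snd (dual_split \<alpha>)" "fst z" "snd z"]
    by (simp add: blinfun_apply_dual_split flip: blinfun.add_right)
qed

end

theory Submission
  imports Defs
begin

text \<open>
  Write \<open>L\<^sub>x\<close> and \<open>R\<^sub>x\<close> for the differentials at the identity of \<open>y \<mapsto> x y\<close> and \<open>y \<mapsto> y x\<close>. From
  \<open>x (x\<^sup>-\<^sup>1 y x) = y x\<close> one gets \<open>L\<^sub>x \<circ> Ad x = R\<^sub>x\<close>, and since \<open>L\<^sub>x\<close> tends to the identity,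
  \<open>x \<mapsto> Ad x \<eta>\<close> is differentiable at the identity, with derivative \<open>\<beta> \<xi> \<eta>\<close> in the direction \<open>\<xi>\<close>,
  bilinear in \<open>\<xi>\<close> and \<open>\<eta>\<close>. One-parameter subgroups are the integral curves through the identity of the
  left invariant fields \<open>x \<mapsto> L\<^sub>x \<xi>\<close>; differentiating \<open>Ad\<close> along them gives \<open>[\<xi>, \<eta>] = \<beta> \<xi> \<eta>\<close>. As \<open>exp (t \<xi>)\<close>
  commutes with \<open>exp (s \<xi>)\<close>, \<open>[\<xi>, \<xi>] = 0\<close>, hence the bracket is antisymmetric.

  The one-parameter subgroups of the semidirect product are \<open>t \<mapsto> (exp (t \<xi>), v t)\<close> with
  \<open>v' t = Ad (exp (- t \<xi>)) \<xi>'\<close> and \<open>v 0 = 0\<close>, and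
  \<open>Ad (g, \<xi>) (\<eta>, \<zeta>) = (Ad g \<eta>, Ad g (\<zeta> - [\<eta>, \<xi>]))\<close>, which yields the bracket
  \<open>([\<xi>, \<eta>], [\<xi>, \<eta>'] - [\<eta>, \<xi>'])\<close>. The rest is duality.
\<close>

section \<open>Finite-dimensional spaces and ordinary differential equations\<close>

text \<open>The bracket is a derivative of \<open>Ad\<close> along \<open>lie_exp\<close>, and
  \<open>lie_exp\<close> is a definite description. No bracket can be evaluated until one-parameter
  subgroups are known to exist and to be unique, in G and again in the semidirect product. In G this
  is a differential equation in the chart; it yields only a short piece of a curve, which the group
  law extends to the line. In the semidirect product the second component has a prescribed
  derivative once the first is known, so an integral replaces a second flow argument. Another
  obstacle is that \<open>Ad x\<close> is a derivative in a different variable, so its dependence on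
  x is not visible from its definition. The relation between left and right translations expresses
  that dependence through first derivatives of the multiplication, which are smooth. The model space
  is a normed space with a finite spanning set. Boundedness of linear maps, uniform from pointwise
  convergence, and reflexivity all come from coordinate functionals.\<close>

lemma finite_span_coordinates:
  fixes B :: "'e::real_normed_vector set"
  assumes "finite B" "span B = UNIV"
  obtains C and c :: "'e \<Rightarrow> 'e \<Rightarrow> real"
  where "finite C" "\<And>b. bounded_linear (c b)" "\<And>x. (\<Sum>b\<in>C. c b x *\<^sub>R b) = x"
proof -
  obtain C where C: "C \<subseteq> B" "independent C" "B \<subseteq> span C"
    using maximal_independent_subset[of B] by metis
  have fin: "finite C" using C(1) assms(1) finite_subset by blast
  have sp: "span C = UNIV"
    using C(3) assms(2) by (metis span_minimal subspace_span top.extremum_uniqueI)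
  define c where "c b x = representation C x b" for b x
  have sum: "(\<Sum>b\<in>C. c b x *\<^sub>R b) = x" for x
    unfolding c_def using real_vector.sum_representation_eq[OF C(2) _ fin subset_refl, of x] sp by auto
  have lin: "linear (c b)" for b
    unfolding c_def
    by (intro linearI) (auto simp: real_vector.representation_add[OF C(2)] real_vector.representation_scale[OF C(2)] sp)
  \<comment> \<open>\<open>K a\<close> consists of the two faces of the coordinate cube on which the
    coordinate at \<open>a\<close> is 1 or -1. Coordinates outside \<open>C\<close> are pinned to 0,
    so Tychonoff gives compactness over the whole index type. The norm attains a minimum there,
    positive by independence.\<close>
  define K where "K a = PiE (UNIV :: 'e set)
      (\<lambda>i. if i \<in> C then if i = a then {-1, 1} else {-1..1} else {0::real})" for a
  have K: "compact (K a)" for a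
    using compactin_PiE[of "\<lambda>_::'e. euclideanreal" UNIV] unfolding K_def
    by (simp add: euclidean_product_topology) 
  have "\<exists>m>0. \<forall>u\<in>K a. m \<le> norm (\<Sum>i\<in>C. u i *\<^sub>R i)" if a: "a \<in> C" for a
  proof -
    have pos: "norm (\<Sum>i\<in>C. u i *\<^sub>R i) > 0" if u: "u \<in> K a" for u
    proof -
      have "u a \<noteq> 0" using PiE_mem[OF u[unfolded K_def], of a] a by auto
      then show ?thesis
        using C(2) a fin independentD[of C C u a] by auto
    qed
    have cont: "continuous_on (K a) (\<lambda>u. norm (\<Sum>i\<in>C. u i *\<^sub>R i))"
      by (intro continuous_intros continuous_on_subset[OF continuous_on_product_coordinates]) auto
    show ?thesis
    proof (cases "K a = {}")
      case False
      from continuous_attains_inf[OF K False cont] pos show ?thesis by blast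
    qed (auto intro: exI[of _ 1])
  qed
  then obtain m where m: "\<And>a. a \<in> C \<Longrightarrow> m a > 0"
      "\<And>a u. a \<in> C \<Longrightarrow> u \<in> K a \<Longrightarrow> m a \<le> norm (\<Sum>i\<in>C. u i *\<^sub>R i)"
    by metis
  have key: "\<exists>N. \<forall>x. \<bar>c b x\<bar> \<le> norm x * N" for b
  proof (cases "b \<in> C")
    case False
    then have "c b x = 0" for x
      unfolding c_def using real_vector.representation_ne_zero by metis
    then show ?thesis by (auto intro!: exI[of _ 0])
  next
    case True
    define N where "N = Max ((\<lambda>a. 1 / m a) ` C)"
    have N: "1 / m a \<le> N" if "a \<in> C" for a
      unfolding N_def using that fin by auto
    have Npos: "N \<ge> 0" using N[OF True] m(1)[OF True]
      by (smt (verit) divide_pos_pos)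
    have "\<bar>c b x\<bar> \<le> norm x * N" for x
    proof -
      \<comment> \<open>Dividing by the modulus of the largest coordinate, the one at
        \<open>a\<close>, moves the coordinate vector of x into \<open>K a\<close>.\<close>
      have "\<exists>a\<in>C. \<forall>i\<in>C. \<bar>c i x\<bar> \<le> \<bar>c a x\<bar>"
        by (rule finite_ne_induct[OF fin, of "\<lambda>C. \<exists>a\<in>C. \<forall>i\<in>C. \<bar>c i x\<bar> \<le> \<bar>c a x\<bar>"])
          (use True in \<open>auto, (metis linear order_trans)+\<close>)
      then obtain a where a: "a \<in> C" "\<And>i. i \<in> C \<Longrightarrow> \<bar>c i x\<bar> \<le> \<bar>c a x\<bar>" by blast
      show ?thesis
      proof (cases "c a x = 0")
        case True
        then show ?thesis using a(2)[OF \<open>b \<in> C\<close>] Npos by simp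
      next
        case False
        define u where "u i = (if i \<in> C then c i x / \<bar>c a x\<bar> else 0)" for i
        have "\<bar>c i x / \<bar>c a x\<bar>\<bar> \<le> 1" if "i \<in> C" for i
          using a(2)[OF that] False by (simp add: divide_simps)
        then have "-1 \<le> u i \<and> u i \<le> 1" if "i \<in> C" for i
          unfolding u_def using that by (metis abs_le_D1 abs_le_D2 minus_le_iff)
        moreover have "u a = -1 \<or> u a = 1"
          unfolding u_def using False a(1) by (auto simp: abs_if)
        ultimately have "u \<in> K a" unfolding K_def by (auto simp: u_def)
        from m(2)[OF a(1) this] have "m a \<le> norm (\<Sum>i\<in>C. u i *\<^sub>R i)" .
        also have "(\<Sum>i\<in>C. u i *\<^sub>R i) = (1 / \<bar>c a x\<bar>) *\<^sub>R (\<Sum>i\<in>C. c i x *\<^sub>R i)"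
          unfolding scaleR_sum_right u_def by (intro sum.cong) auto
        also have "\<dots> = (1 / \<bar>c a x\<bar>) *\<^sub>R x" by (simp add: sum)
        finally have "m a * \<bar>c a x\<bar> \<le> norm x" using False by (simp add: divide_simps)
        then have "\<bar>c a x\<bar> \<le> norm x * (1 / m a)" using m(1)[OF a(1)] by (simp add: field_simps)
        also have "\<dots> \<le> norm x * N" using N[OF a(1)] by (intro mult_left_mono) auto
        finally show ?thesis using a(2)[OF \<open>b \<in> C\<close>] by linarith
      qed
    qed
    then show ?thesis by blast
  qed
  have "bounded_linear (c b)" for b
    using key[of b] lin[of b] by (auto simp: bounded_linear_def bounded_linear_axioms_def)
  with fin sum show ?thesis using that by blast
qed

lemma linear_imp_bounded_linear_finite_span:
  fixes B :: "'e::real_normed_vector set" and f :: "'e \<Rightarrow> 'f::real_normed_vector"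
  assumes "finite B" "span B = UNIV" "linear f"
  shows "bounded_linear f"
proof -
  obtain C and c :: "'e \<Rightarrow> 'e \<Rightarrow> real" where C: "finite C" "\<And>b. bounded_linear (c b)"
    "\<And>x. (\<Sum>b\<in>C. c b x *\<^sub>R b) = x"
    using finite_span_coordinates[OF assms(1,2)] by metis
  have "f = (\<lambda>x. \<Sum>b\<in>C. c b x *\<^sub>R f b)"
    using assms(3) C(3) by (metis (no_types, lifting) linear_sum linear_cmul sum.cong)
  moreover have "bounded_linear (\<lambda>x. \<Sum>b\<in>C. c b x *\<^sub>R f b)"
    by (intro bounded_linear_sum bounded_linear_scaleR_const C(2))
  ultimately show ?thesis by simp
qed

text \<open>\<open>C\<close> and \<open>k\<close> are chosen before f, so smallness at finitely many
  vectors controls operator norms over a whole family of linear maps. \<open>k\<close> is the sum of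
  the norms of the coordinate functionals, plus 1 for positivity.\<close>

lemma pointwise_bound_finite_span:
  fixes B :: "'e::real_normed_vector set"
  assumes "finite B" "span B = UNIV"
  obtains C k where "finite C" "k > 0"
    "\<And>f :: 'e \<Rightarrow> 'f::real_normed_vector. \<And>\<epsilon> v. linear f \<Longrightarrow> (\<And>b. b \<in> C \<Longrightarrow> norm (f b) \<le> \<epsilon>)
       \<Longrightarrow> 0 \<le> \<epsilon> \<Longrightarrow> norm (f v) \<le> k * \<epsilon> * norm v"
proof -
  obtain C and c :: "'e \<Rightarrow> 'e \<Rightarrow> real" where C: "finite C" "\<And>b. bounded_linear (c b)"
    "\<And>x. (\<Sum>b\<in>C. c b x *\<^sub>R b) = x"
    using finite_span_coordinates[OF assms(1,2)] by metis
  define k where "k = (\<Sum>b\<in>C. onorm (c b)) + 1"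
  have k0: "(\<Sum>b\<in>C. onorm (c b)) \<ge> 0" by (intro sum_nonneg onorm_pos_le C)
  have "norm (f v) \<le> k * \<epsilon> * norm v"
    if f: "linear f" "\<And>b. b \<in> C \<Longrightarrow> norm (f b) \<le> \<epsilon>" "0 \<le> \<epsilon>" for f :: "'e \<Rightarrow> 'f" and \<epsilon> v
  proof -
    have "f v = (\<Sum>b\<in>C. c b v *\<^sub>R f b)"
      using f(1) C(3) by (metis (no_types, lifting) linear_sum linear_cmul sum.cong)
    also have "norm \<dots> \<le> (\<Sum>b\<in>C. (onorm (c b) * norm v) * \<epsilon>)"
      by (intro sum_norm_le) (auto intro!: mult_mono f onorm_pos_le C mult_nonneg_nonneg simp: onorm[OF C(2), simplified])
    also have "\<dots> = (\<Sum>b\<in>C. onorm (c b)) * \<epsilon> * norm v"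
      by (simp add: sum_distrib_left sum_distrib_right mult_ac)
    also have "\<dots> \<le> k * \<epsilon> * norm v"
      unfolding k_def using f(3) by (intro mult_right_mono) auto
    finally show ?thesis .
  qed
  moreover have "k > 0" unfolding k_def using k0 by simp
  ultimately show ?thesis using that C(1) by blast
qed

text \<open>Upgrades limits of linear maps that are known for each fixed vector, such as those of
  \<open>left_diff x v\<close>, to estimates uniform in the vector.\<close>

lemma eventually_uniformly_small_finite_span:
  fixes B :: "'e::real_normed_vector set" and A :: "'a \<Rightarrow> 'e \<Rightarrow> 'f::real_normed_vector"
  assumes "finite B" "span B = UNIV" "eventually (\<lambda>t. linear (A t)) F"
    and "\<And>v. ((\<lambda>t. A t v) \<longlongrightarrow> 0) F" and "\<epsilon> > 0"
  shows "eventually (\<lambda>t. \<forall>v. norm (A t v) \<le> \<epsilon> * norm v) F"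
proof -
  obtain C k where C: "finite C" "k > 0"
    "\<And>f :: 'e \<Rightarrow> 'f. \<And>\<epsilon> v. linear f \<Longrightarrow> (\<And>b. b \<in> C \<Longrightarrow> norm (f b) \<le> \<epsilon>)
       \<Longrightarrow> 0 \<le> \<epsilon> \<Longrightarrow> norm (f v) \<le> k * \<epsilon> * norm v"
    using pointwise_bound_finite_span[OF assms(1,2), where 'f = 'f] by metis
  have "eventually (\<lambda>t. \<forall>b\<in>C. norm (A t b) < \<epsilon> / k) F"
    using assms(4,5) C(1,2)
    by (intro eventually_ball_finite) (auto simp: tendsto_iff)
  with assms(3) show ?thesis
  proof eventually_elim
    case (elim t)
    show ?case
      using C(3)[OF elim(1), of "\<epsilon> / k"] elim(2) C(2) assms(5) by (auto simp: less_imp_le)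
  qed
qed

text \<open>The coordinate functionals \<open>c b\<close> span the dual: a functional is the sum of
  its values at b times \<open>c b\<close>. Hence \<Lambda> is evaluation at the vector whose
  coordinates are the values of \<Lambda> at the \<open>c b\<close>. This legitimises the definite
  description in \<open>functional_derivative\<close>.\<close>

lemma bidual_finite_span:
  fixes B :: "'e::real_normed_vector set" and \<Lambda> :: "('e \<Rightarrow>\<^sub>L real) \<Rightarrow> real"
  assumes "finite B" "span B = UNIV" "linear \<Lambda>"
  shows "\<exists>!\<xi>. \<forall>\<beta>. \<Lambda> \<beta> = blinfun_apply \<beta> \<xi>"
proof -
  obtain C and c :: "'e \<Rightarrow> 'e \<Rightarrow> real" where C: "finite C" "\<And>b. bounded_linear (c b)"
    "\<And>x. (\<Sum>b\<in>C. c b x *\<^sub>R b) = x"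
    using finite_span_coordinates[OF assms(1,2)] by metis
  show ?thesis
  proof
    have "\<Lambda> \<beta> = blinfun_apply \<beta> (\<Sum>b\<in>C. \<Lambda> (Blinfun (c b)) *\<^sub>R b)" for \<beta>
    proof -
      have "\<beta> = (\<Sum>b\<in>C. blinfun_apply \<beta> b *\<^sub>R Blinfun (c b))"
      proof (rule blinfun_eqI)
        fix x
        have "blinfun_apply \<beta> x = blinfun_apply \<beta> (\<Sum>b\<in>C. c b x *\<^sub>R b)" by (simp add: C(3))
        also have "\<dots> = (\<Sum>b\<in>C. c b x * blinfun_apply \<beta> b)"
          by (simp add: blinfun.sum_right blinfun.scaleR_right)
        also have "\<dots> = blinfun_apply (\<Sum>b\<in>C. blinfun_apply \<beta> b *\<^sub>R Blinfun (c b)) x"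
          by (simp add: blinfun.sum_left blinfun.scaleR_left bounded_linear_Blinfun_apply[OF C(2)] mult.commute)
        finally show "blinfun_apply \<beta> x = \<dots>" .
      qed
      then have "\<Lambda> \<beta> = \<Lambda> (\<Sum>b\<in>C. blinfun_apply \<beta> b *\<^sub>R Blinfun (c b))" by simp
      also have "\<dots> = (\<Sum>b\<in>C. blinfun_apply \<beta> b * \<Lambda> (Blinfun (c b)))"
        using assms(3) by (simp add: linear_sum linear_cmul)
      also have "\<dots> = blinfun_apply \<beta> (\<Sum>b\<in>C. \<Lambda> (Blinfun (c b)) *\<^sub>R b)"
        by (simp add: blinfun.sum_right blinfun.scaleR_right mult.commute)
      finally show ?thesis .
    qed
    then show "\<forall>\<beta>. \<Lambda> \<beta> = blinfun_apply \<beta> (\<Sum>b\<in>C. \<Lambda> (Blinfun (c b)) *\<^sub>R b)" by blast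
  next
    fix \<xi> assume \<xi>: "\<forall>\<beta>. \<Lambda> \<beta> = blinfun_apply \<beta> \<xi>"
    have "c b \<xi> = \<Lambda> (Blinfun (c b))" for b
      using \<xi> by (simp add: bounded_linear_Blinfun_apply[OF C(2)])
    then show "\<xi> = (\<Sum>b\<in>C. \<Lambda> (Blinfun (c b)) *\<^sub>R b)"
      using C(3)[of \<xi>] by simp
  qed
qed

lemma span_Times_finite:
  fixes B :: "'e::real_normed_vector set" and B' :: "'f::real_normed_vector set"
  assumes "finite B" "span B = UNIV" "finite B'" "span B' = UNIV"
  shows "finite ((\<lambda>x. (x, 0)) ` B \<union> (\<lambda>y. (0, y)) ` B')"
    "span ((\<lambda>x. (x, 0)) ` B \<union> (\<lambda>y. (0, y)) ` B') = UNIV"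
proof -
  show "finite ((\<lambda>x. (x, 0)) ` B \<union> (\<lambda>y. (0, y)) ` B')" using assms by simp
  have l: "linear (\<lambda>x::'e. (x, 0::'f))" "linear (\<lambda>y::'f. (0::'e, y))"
    by (auto intro!: linearI)
  have "(x, y) \<in> span ((\<lambda>x. (x, 0)) ` B \<union> (\<lambda>y. (0, y)) ` B')" for x y
  proof -
    have "(x, 0) \<in> span ((\<lambda>x. (x, 0::'f)) ` B)" "(0, y) \<in> span ((\<lambda>y. (0::'e, y)) ` B')"
      using linear_span_image[OF l(1), of B] linear_span_image[OF l(2), of B'] assms by auto
    then have "(x, 0) + (0, y) \<in> span ((\<lambda>x. (x, 0)) ` B \<union> (\<lambda>y. (0, y)) ` B')"
      by (intro span_add) (meson span_mono subsetD sup_ge1 sup_ge2)+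
    then show ?thesis by simp
  qed
  then show "span ((\<lambda>x. (x, 0)) ` B \<union> (\<lambda>y. (0, y)) ` B') = UNIV" by auto
qed

section \<open>Antiderivatives and autonomous differential equations\<close>

lemma antiderivative_interval_exists:
  fixes w :: "real \<Rightarrow> 'e::banach"
  assumes "continuous_on {-d..d} w" "0 \<le> d"
  shows "\<exists>W. W 0 = 0 \<and> (\<forall>t\<in>{-d..d}. (W has_vector_derivative w t) (at t within {-d..d}))"
proof -
  let ?W = "\<lambda>t. integral {-d..t} w - integral {-d..0} w"
  have W: "(?W has_vector_derivative w t) (at t within {-d..d})" if "t \<in> {-d..d}" for t
    using integral_has_vector_derivative[OF assms(1) that] by (auto intro!: derivative_eq_intros)
  then show ?thesis by (intro exI[of _ ?W]) auto
qed

lemma antiderivative_exists: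
  fixes w :: "real \<Rightarrow> 'e::banach"
  assumes "continuous_on UNIV w"
  obtains W where "W 0 = 0" "\<And>t. (W has_vector_derivative w t) (at t)"
\<comment> \<open>One of the two integrals is always over an empty or degenerate interval and
  vanishes; the difference is the signed integral from 0 to t.\<close>
proof (rule that[of "\<lambda>t. integral {0..t} w - integral {t..0} w"])
  let ?W = "\<lambda>t. integral {0..t} w - integral {t..0} w"
  show "?W 0 = 0" by simp
  fix t :: real
  define d where "d = \<bar>t\<bar> + 1"
  have cont: "continuous_on S w" for S using assms continuous_on_subset by blast
  have z1: "integral {0..s} w = 0" if "s \<le> 0" for s using that by (cases "s = 0") auto
  have z2: "integral {s..0} w = 0" if "s \<ge> 0" for s using that by (cases "s = 0") auto
  have eq: "?W s = integral {-d..s} w - integral {-d..0} w" if "s \<in> {-d..d}" for s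
    using that z1[of s] z2[of s] Henstock_Kurzweil_Integration.integral_combine[of "-d" 0 s w]
      Henstock_Kurzweil_Integration.integral_combine[of "-d" s 0 w]
      integrable_continuous_real[OF cont]
    by (cases "s \<ge> 0") (auto simp: algebra_simps d_def)
  have "t \<in> {-d..d}" "t \<in> {-d<..<d}" unfolding d_def by auto
  from integral_has_vector_derivative[OF cont this(1)]
  have "((\<lambda>s. integral {-d..s} w - integral {-d..0} w) has_vector_derivative w t) (at t within {-d..d})"
    by (auto intro!: derivative_eq_intros)
  then have "(?W has_vector_derivative w t) (at t within {-d..d})"
    by (rule has_vector_derivative_transform[OF \<open>t \<in> {-d..d}\<close>, rotated]) (rule eq)
  then show "(?W has_vector_derivative w t) (at t)"
    using at_within_interior[of t "{-d..d}"] \<open>t \<in> {-d<..<d}\<close> by (simp add: interior_atLeastAtMost_real)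
qed

lemma antiderivative_bound:
  fixes W :: "real \<Rightarrow> 'e::real_normed_vector"
  assumes "\<And>t. t \<in> {-d..d} \<Longrightarrow> (W has_vector_derivative w t) (at t within {-d..d})"
    and "\<And>t. t \<in> {-d..d} \<Longrightarrow> norm (w t) \<le> K" and "W 0 = 0" "\<bar>t\<bar> \<le> d"
  shows "norm (W t) \<le> K * \<bar>t\<bar>"
proof -
  have "norm (W t - W 0) \<le> K * norm (t - 0)"
  proof (rule differentiable_bound[of "{-d..d}" W "\<lambda>t h. h *\<^sub>R w t"])
    show "onorm (\<lambda>h. h *\<^sub>R w t) \<le> K" if "t \<in> {-d..d}" for t
      by (rule onorm_le) (use assms(2)[OF that] in \<open>simp add: mult.commute[of K] mult_left_mono\<close>)
  qed (use assms in \<open>auto simp: has_vector_derivative_def\<close>)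
  then show ?thesis using assms(3) by simp
qed

text \<open>A short-time substitute for Gronwall's inequality: if m is the largest distance between
  the two solutions, integrating the Lipschitz bound gives m \<le> L d m, which forces m = 0 when L
  d < 1.\<close>

lemma autonomous_ode_unique:
  fixes V :: "'e::real_normed_vector \<Rightarrow> 'e"
  assumes lip: "\<And>x y. x \<in> S \<Longrightarrow> y \<in> S \<Longrightarrow> norm (V x - V y) \<le> L * norm (x - y)"
    and x: "\<And>t. t \<in> {-d..d} \<Longrightarrow> x t \<in> S"
      "\<And>t. t \<in> {-d..d} \<Longrightarrow> (x has_vector_derivative V (x t)) (at t within {-d..d})"
    and y: "\<And>t. t \<in> {-d..d} \<Longrightarrow> y t \<in> S"
      "\<And>t. t \<in> {-d..d} \<Longrightarrow> (y has_vector_derivative V (y t)) (at t within {-d..d})"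
    and "x 0 = y 0" "0 \<le> L" "L * d < 1" "t \<in> {-d..d}"
  shows "x t = y t"
proof -
  have ne: "{-d..d} \<noteq> {}" using assms by auto
  have cont: "continuous_on {-d..d} (\<lambda>t. norm (x t - y t))"
    by (intro continuous_intros; (rule continuous_on_vector_derivative, (rule x y), assumption))
  obtain s where s: "s \<in> {-d..d}" "\<And>u. u \<in> {-d..d} \<Longrightarrow> norm (x u - y u) \<le> norm (x s - y s)"
    using continuous_attains_sup[OF compact_Icc ne cont] by blast
  let ?m = "norm (x s - y s)"
  have "norm (x s - y s) \<le> (L * ?m) * \<bar>s\<bar>"
  proof (rule antiderivative_bound[of d "\<lambda>t. x t - y t" "\<lambda>t. V (x t) - V (y t)"])
    show "norm (V (x u) - V (y u)) \<le> L * ?m" if "u \<in> {-d..d}" for u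
      using lip[OF x(1)[OF that] y(1)[OF that]] s(2)[OF that] mult_left_mono[OF s(2)[OF that] \<open>0 \<le> L\<close>]
      by linarith
  qed (use assms s in \<open>auto intro!: derivative_intros\<close>)
  also have "\<dots> \<le> (L * ?m) * d" using s \<open>0 \<le> L\<close> by (intro mult_left_mono) auto
  finally have "?m * (1 - L * d) \<le> 0" by (simp add: algebra_simps)
  with \<open>L * d < 1\<close> have "?m \<le> 0" by (simp add: mult_le_0_iff)
  with s(2)[OF \<open>t \<in> {-d..d}\<close>] show ?thesis by simp
qed

text \<open>Picard iteration, with functions on \<open>[-d, d]\<close> extended to the line by clamping the time.\<close>

lemma autonomous_ode_exists:
  fixes V :: "'e::banach \<Rightarrow> 'e"
  assumes "r > 0" "L \<ge> 0"
    and lip: "\<And>x y. x \<in> cball e r \<Longrightarrow> y \<in> cball e r \<Longrightarrow> norm (V x - V y) \<le> L * norm (x - y)"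
  obtains d x where "d > 0" "x 0 = e" "\<And>t. t \<in> {-d..d} \<Longrightarrow> x t \<in> cball e r"
    "\<And>t. t \<in> {-d..d} \<Longrightarrow> (x has_vector_derivative V (x t)) (at t within {-d..d})"
proof -
  define K where "K = norm (V e) + L * r + 1"
  have K0: "K > 0" unfolding K_def using assms by (smt (verit) mult_nonneg_nonneg norm_ge_zero)
  have Kb: "norm (V x) \<le> K" if "x \<in> cball e r" for x
  proof -
    have "norm (V x) \<le> norm (V e) + norm (V x - V e)" by (metis norm_triangle_sub)
    also have "norm (V x - V e) \<le> L * norm (x - e)" using lip[OF that] assms by auto
    also have "\<dots> \<le> L * r" using that assms by (intro mult_left_mono) (auto simp: dist_norm norm_minus_commute)
    finally show ?thesis unfolding K_def by simp
  qed
  \<comment> \<open>The first entry keeps integrals of V within distance r of the centre, as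
    \<open>K\<close> bounds V on the ball. The second makes the Picard map contract by 1/2, with L +
    1 to cover L = 0.\<close>
  define d where "d = min (r / K) (1 / (2 * (L + 1)))"
  have d: "d > 0" "K * d \<le> r" "L * d \<le> 1/2"
  proof -
    show "d > 0" unfolding d_def using assms K0 by simp
    have "K * d \<le> K * (r / K)" unfolding d_def using K0 by (intro mult_left_mono) auto
    then show "K * d \<le> r" using K0 by simp
    have "L * d \<le> L * (1 / (2 * (L + 1)))" unfolding d_def using assms by (intro mult_left_mono) auto
    also have "\<dots> \<le> 1/2" using assms by (simp add: divide_simps)
    finally show "L * d \<le> 1/2" .
  qed
  define A where "A w = (SOME W. W 0 = 0 \<and>
      (\<forall>t\<in>{-d..d}. (W has_vector_derivative w t) (at t within {-d..d})))" for w :: "real \<Rightarrow> 'e"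
  have A: "A w 0 = 0" "\<And>t. t \<in> {-d..d} \<Longrightarrow> (A w has_vector_derivative w t) (at t within {-d..d})"
    if "continuous_on {-d..d} w" for w
    using someI_ex[OF antiderivative_interval_exists[OF that less_imp_le[OF d(1)]]] unfolding A_def by auto
  define S where "S = PiC (UNIV :: real set) (\<lambda>_. cball e r)"
  define cl where "cl t = max (-d) (min d t)" for t :: real
  have cl: "cl t \<in> {-d..d}" "continuous_on UNIV cl" "t \<in> {-d..d} \<Longrightarrow> cl t = t" for t
    using d(1) unfolding cl_def by (auto intro!: continuous_intros)
  define T where "T f = Bcontfun (\<lambda>t. e + A (\<lambda>s. V (apply_bcontfun f s)) (cl t))" for f
  have S_mem: "f \<in> S \<longleftrightarrow> (\<forall>t. apply_bcontfun f t \<in> cball e r)" for f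
    unfolding S_def mem_PiC_iff by auto
  have cV: "continuous_on {-d..d} (\<lambda>s. V (apply_bcontfun f s))" if "f \<in> S" for f
  proof (rule continuous_on_compose2[of "cball e r" V])
    show "continuous_on (cball e r) V"
      using lip assms(2) by (intro lipschitz_on_continuous_on[of L] lipschitz_onI) (auto simp: dist_norm)
    show "continuous_on {-d..d} (apply_bcontfun f)" by simp
  qed (use that S_mem in auto)
  have ball: "norm (A (\<lambda>s. V (apply_bcontfun f s)) (cl t)) \<le> r" if "f \<in> S" for f t
  proof -
    have "norm (A (\<lambda>s. V (apply_bcontfun f s)) (cl t)) \<le> K * \<bar>cl t\<bar>"
      by (rule antiderivative_bound[of d _ "\<lambda>s. V (apply_bcontfun f s)"])
        (use A[OF cV[OF that]] cl(1)[of t] that S_mem Kb in auto)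
    also have "\<dots> \<le> K * d" using cl(1)[of t] K0 by (intro mult_left_mono) auto
    finally show ?thesis using d(2) by simp
  qed
  have T: "apply_bcontfun (T f) t = e + A (\<lambda>s. V (apply_bcontfun f s)) (cl t)" if "f \<in> S" for f t
  proof -
    have "continuous_on {-d..d} (A (\<lambda>s. V (apply_bcontfun f s)))"
      by (rule continuous_on_vector_derivative[OF A(2)[OF cV[OF that]]])
    then have "continuous_on UNIV (\<lambda>t. A (\<lambda>s. V (apply_bcontfun f s)) (cl t))"
      by (rule continuous_on_compose2[OF _ cl(2)]) (use cl(1) in auto)
    moreover have "norm (e + A (\<lambda>s. V (apply_bcontfun f s)) (cl t)) \<le> norm e + r" for t
      using ball[OF that, of t] norm_triangle_ineq[of e] by (smt (verit))
    ultimately show ?thesis unfolding T_def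
      by (subst Bcontfun_inverse) (auto intro!: bcontfun_normI continuous_intros)
  qed
  have "\<exists>!f\<in>S. T f = f"
  proof (rule Banach_fix[of S "1/2"])
    show "complete S" unfolding S_def by (intro closed_PiC[THEN complete_eq_closed[THEN iffD2]]) auto
    have "const_bcontfun e \<in> S" unfolding S_mem using assms by (simp add: const_bcontfun.rep_eq)
    then show "S \<noteq> {}" by auto
    show "T ` S \<subseteq> S"
      using ball by (auto simp: S_mem T dist_norm)
    fix f g assume fg: "f \<in> S" "g \<in> S"
    show "dist (T f) (T g) \<le> 1/2 * dist f g"
    proof (rule dist_bound)
      fix t
      have "norm (A (\<lambda>s. V (apply_bcontfun f s)) (cl t) - A (\<lambda>s. V (apply_bcontfun g s)) (cl t))
          \<le> (L * dist f g) * \<bar>cl t\<bar>"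
      proof (rule antiderivative_bound[of d _ "\<lambda>s. V (apply_bcontfun f s) - V (apply_bcontfun g s)"])
        fix s
        have "norm (V (apply_bcontfun f s) - V (apply_bcontfun g s))
            \<le> L * dist (apply_bcontfun f s) (apply_bcontfun g s)"
          using lip fg S_mem by (auto simp: dist_norm)
        also have "\<dots> \<le> L * dist f g" by (intro mult_left_mono dist_bounded assms)
        finally show "norm (V (apply_bcontfun f s) - V (apply_bcontfun g s)) \<le> L * dist f g" .
      qed (use A[OF cV[OF fg(1)]] A[OF cV[OF fg(2)]] cl(1)[of t] in \<open>auto intro!: derivative_intros\<close>)
      also have "\<dots> \<le> (L * dist f g) * d"
        using cl(1)[of t] assms by (intro mult_left_mono) auto
      also have "\<dots> \<le> 1/2 * dist f g"
        using mult_right_mono[OF d(3), of "dist f g"] by (simp add: mult_ac)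
      finally show "dist (apply_bcontfun (T f) t) (apply_bcontfun (T g) t) \<le> 1/2 * dist f g"
        by (simp add: T fg dist_norm)
    qed
  qed auto
  then obtain f where f: "f \<in> S" "T f = f" by blast
  define x where "x = apply_bcontfun f"
  have x: "x t = e + A (\<lambda>s. V (x s)) (cl t)" for t
    using T[OF f(1), of t] f(2) unfolding x_def by simp
  note AV = A[OF cV[OF f(1)], folded x_def]
  show ?thesis
  proof (rule that[OF d(1), of x])
    show "x 0 = e" using x[of 0] AV(1) cl(3)[of 0] d(1) by simp
    show "x t \<in> cball e r" for t using f(1) S_mem unfolding x_def by blast
    fix t assume t: "t \<in> {-d..d}"
    have "((\<lambda>t. e + A (\<lambda>s. V (x s)) t) has_vector_derivative V (x t)) (at t within {-d..d})"
      using AV(2)[OF t] by (auto intro!: derivative_eq_intros)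
    then show "(x has_vector_derivative V (x t)) (at t within {-d..d})"
      by (rule has_vector_derivative_transform[OF t, rotated]) (subst x, simp add: cl(3))
  qed
qed

section \<open>Smooth maps and identities of germs\<close>

lemma smooth_on_differentiable: "smooth_on S f \<Longrightarrow> x \<in> S \<Longrightarrow> f differentiable (at x)"
  unfolding smooth_on_def by (metis Ck_on.simps(2))

lemma smooth_on_frechet_derivative:
  "smooth_on S f \<Longrightarrow> smooth_on S (\<lambda>x. frechet_derivative f (at x) v)"
  unfolding smooth_on_def by (metis Ck_on.simps(2))

lemma smooth_on_continuous: "smooth_on S f \<Longrightarrow> continuous_on S f"
  unfolding smooth_on_def by (metis Ck_on.simps(1))

text \<open>Products are sure to stay inside a chart only near a given point, so identities of
  coordinate expressions are available only there; this passes them on to differentials.\<close>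

lemma has_derivative_eventually_unique:
  assumes "(f has_derivative f') (at x)" "(g has_derivative g') (at x)"
    and "\<forall>\<^sub>F y in nhds x. f y = g y"
  shows "f' = g'"
proof -
  have "(g has_derivative f') (at x)"
    using has_derivative_transform_eventually[OF assms(1), of g] assms(3)
    by (auto simp: eventually_nhds_conv_at)
  then show ?thesis using assms(2) has_derivative_unique by blast
qed

lemma differentiable_eventually_cong:
  assumes "f differentiable (at x)" "\<forall>\<^sub>F y in nhds x. f y = g y"
  shows "g differentiable (at x)"
proof -
  obtain f' where "(f has_derivative f') (at x)" using assms(1) unfolding differentiable_def by blast
  then have "(g has_derivative f') (at x)"
    using has_derivative_transform_eventually[of f f' x UNIV g] assms(2)
    by (auto simp: eventually_nhds_conv_at)
  then show ?thesis unfolding differentiable_def by blast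
qed

lemma eventually_isCont_open:
  assumes "isCont f x" "open S" "f x \<in> S"
  shows "\<forall>\<^sub>F y in nhds x. f y \<in> S"
  using assms unfolding isCont_def tendsto_at_iff_tendsto_nhds by (metis topological_tendstoD)

section \<open>Charts\<close>

context
  fixes X :: "'m topology" and A :: "('m, 'e::banach) chart set" and c :: "('m, 'e) chart"
  assumes mfd: "smooth_manifold X A" and c: "c \<in> A"
begin

lemma chart_openin: "openin X (fst c)"
  using mfd c unfolding smooth_manifold_def by (metis (no_types, lifting) case_prodD prod.collapse)

lemma chart_homeomorphic:
  "homeomorphic_map (subtopology X (fst c)) (top_of_set (snd c ` fst c)) (snd c)"
  and chart_range_open: "open (snd c ` fst c)"
  using mfd c unfolding smooth_manifold_def by (metis (no_types, lifting) case_prodD prod.collapse)+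

lemma chart_subset_topspace: "fst c \<subseteq> topspace X"
  using chart_openin openin_subset by blast

lemma chart_inj: "inj_on (snd c) (fst c)"
  using homeomorphic_imp_injective_map[OF chart_homeomorphic] chart_subset_topspace
  by (simp add: topspace_subtopology inf.absorb2)

lemma chart_inv_in: "x \<in> snd c ` fst c \<Longrightarrow> chart_inv c x \<in> fst c"
  unfolding chart_inv_def by (rule inv_into_into)

lemma chart_chart_inv: "x \<in> snd c ` fst c \<Longrightarrow> snd c (chart_inv c x) = x"
  unfolding chart_inv_def by (rule f_inv_into_f)

lemma chart_inv_chart: "g \<in> fst c \<Longrightarrow> chart_inv c (snd c g) = g"
  unfolding chart_inv_def by (rule inv_into_f_f[OF chart_inj])

lemma open_chart_image:
  assumes "openin X S" "S \<subseteq> fst c"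
  shows "open (snd c ` S)"
proof -
  have "openin (subtopology X (fst c)) S"
    using assms by (simp add: openin_open_subtopology chart_openin)
  then have "openin (top_of_set (snd c ` fst c)) (snd c ` S)"
    using homeomorphic_imp_open_map[OF chart_homeomorphic] unfolding open_map_def by blast
  then show ?thesis using chart_range_open openin_open_trans by blast
qed

lemma continuous_map_chart_inv: "continuous_map (top_of_set (snd c ` fst c)) X (chart_inv c)"
  unfolding continuous_map_def
proof (intro conjI allI impI funcsetI)
  show "chart_inv c x \<in> topspace X" if "x \<in> topspace (top_of_set (snd c ` fst c))" for x
    using that chart_inv_in chart_subset_topspace by auto
  fix S assume S: "openin X S"
  have eq: "{x \<in> topspace (top_of_set (snd c ` fst c)). chart_inv c x \<in> S} = snd c ` (S \<inter> fst c)"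
    by (auto simp: chart_inv_chart)
  have "open (snd c ` (S \<inter> fst c))"
    using S chart_openin by (intro open_chart_image) auto
  then show "openin (top_of_set (snd c ` fst c))
      {x \<in> topspace (top_of_set (snd c ` fst c)). chart_inv c x \<in> S}"
    unfolding eq by (intro open_subset image_mono Int_lower2)
qed

end

lemma chart_inv_prod_chart:
  assumes "inj_on (snd c) (fst c)" "inj_on (snd d) (fst d)"
    and "x \<in> snd c ` fst c" "y \<in> snd d ` fst d"
  shows "chart_inv (prod_chart c d) (x, y) = (chart_inv c x, chart_inv d y)"
proof -
  have "inj_on (map_prod (snd c) (snd d)) (fst c \<times> fst d)"
    using assms(1,2) by (rule map_prod_inj_on)
  then show ?thesis
    using assms(3,4) unfolding chart_inv_def prod_chart_def
    by (intro inv_into_f_eq) (auto intro: inv_into_into simp: f_inv_into_f)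
qed

section \<open>The adjoint action in a chart\<close>

locale lie_group_chart =
  fixes G :: "('g, 'e::banach) lie_grp" (structure) and c :: "('g, 'e) chart"
  assumes lie: "lie_group G" and c_one: "chart_at_one G c"
begin

sublocale group G using lie unfolding lie_group_def by blast

lemma mfd: "smooth_manifold (topol G) (atlas G)" and topspace: "topspace (topol G) = carrier G"
  and smooth_mult: "smooth_map (prod_topology (topol G) (topol G)) (prod_atlas (atlas G) (atlas G))
       (topol G) (atlas G) (\<lambda>(g, h). g \<otimes> h)"
  using lie unfolding lie_group_def by auto

lemma c_atlas: "c \<in> atlas G" and one_in_c: "\<one> \<in> fst c"
  using c_one unfolding chart_at_one_def by auto

lemma chart_carrier: "d \<in> atlas G \<Longrightarrow> fst d \<subseteq> carrier G"
  using chart_subset_topspace[OF mfd] topspace by auto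

lemma chart_around:
  assumes "g \<in> carrier G" obtains d where "d \<in> atlas G" "g \<in> fst d"
proof -
  have "\<Union>(fst ` atlas G) = carrier G" using mfd topspace unfolding smooth_manifold_def by auto
  then show ?thesis using assms that by blast
qed

lemma continuous_map_mult:
  "continuous_map (prod_topology (topol G) (topol G)) (topol G) (\<lambda>(g, h). g \<otimes> h)"
  using smooth_mult unfolding smooth_map_def by blast

lemma finite_span: obtains B :: "'e set" where "finite B" "span B = UNIV"
  using mfd unfolding smooth_manifold_def by blast

text \<open>Shaped like the condition in \<open>smooth_map\<close>, so that smoothness of the
  multiplication in charts is an instance of it. The three charts are independent because
  conjugation by an arbitrary g may leave the chart \<open>c\<close> on the way.\<close>

definition mult_dom :: "('g, 'e) chart \<Rightarrow> ('g, 'e) chart \<Rightarrow> ('g, 'e) chart \<Rightarrow> ('e \<times> 'e) set" where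
  "mult_dom c1 c2 c3 = snd (prod_chart c1 c2) ` (fst (prod_chart c1 c2) \<inter> (\<lambda>(g, h). g \<otimes> h) -` fst c3)"

definition mult_in :: "('g, 'e) chart \<Rightarrow> ('g, 'e) chart \<Rightarrow> ('g, 'e) chart \<Rightarrow> 'e \<times> 'e \<Rightarrow> 'e" where
  "mult_in c1 c2 c3 = snd c3 \<circ> (\<lambda>(g, h). g \<otimes> h) \<circ> chart_inv (prod_chart c1 c2)"

context
  fixes c1 c2 c3 :: "('g, 'e) chart"
  assumes at: "c1 \<in> atlas G" "c2 \<in> atlas G" "c3 \<in> atlas G"
begin

lemma mult_in_eq:
  assumes "x \<in> snd c1 ` fst c1" "y \<in> snd c2 ` fst c2"
  shows "mult_in c1 c2 c3 (x, y) = snd c3 (chart_inv c1 x \<otimes> chart_inv c2 y)"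
  using chart_inv_prod_chart[OF chart_inj[OF mfd at(1)] chart_inj[OF mfd at(2)] assms]
  by (simp add: mult_in_def)

lemma mem_mult_dom_iff:
  "(x, y) \<in> mult_dom c1 c2 c3 \<longleftrightarrow>
     x \<in> snd c1 ` fst c1 \<and> y \<in> snd c2 ` fst c2 \<and> chart_inv c1 x \<otimes> chart_inv c2 y \<in> fst c3"
proof
  assume "(x, y) \<in> mult_dom c1 c2 c3"
  then show "x \<in> snd c1 ` fst c1 \<and> y \<in> snd c2 ` fst c2 \<and> chart_inv c1 x \<otimes> chart_inv c2 y \<in> fst c3"
    unfolding mult_dom_def prod_chart_def
    by (auto simp: chart_inv_chart[OF mfd at(1)] chart_inv_chart[OF mfd at(2)])
next
  assume *: "x \<in> snd c1 ` fst c1 \<and> y \<in> snd c2 ` fst c2 \<and> chart_inv c1 x \<otimes> chart_inv c2 y \<in> fst c3"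
  then have "(x, y) = map_prod (snd c1) (snd c2) (chart_inv c1 x, chart_inv c2 y)"
    by (simp add: chart_chart_inv[OF mfd at(1)] chart_chart_inv[OF mfd at(2)])
  with * show "(x, y) \<in> mult_dom c1 c2 c3"
    unfolding mult_dom_def prod_chart_def
    by (intro image_eqI[of _ _ "(chart_inv c1 x, chart_inv c2 y)"])
      (auto intro: chart_inv_in[OF mfd at(1)] chart_inv_in[OF mfd at(2)])
qed

lemma smooth_mult_in: "smooth_on (mult_dom c1 c2 c3) (mult_in c1 c2 c3)"
proof -
  have "prod_chart c1 c2 \<in> prod_atlas (atlas G) (atlas G)" using at unfolding prod_atlas_def by blast
  with smooth_mult at(3) show ?thesis
    unfolding smooth_map_def mult_dom_def mult_in_def by (metis (no_types, lifting) case_prodD prod.collapse)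
qed

text \<open>By continuity, factors of a product in \<open>c3\<close> lie in an open rectangle whose
  products stay in \<open>c3\<close>, and the charts map it to an open rectangle. This makes
  membership in the domain an eventual property.\<close>

lemma open_mult_dom: "open (mult_dom c1 c2 c3)"
proof (subst open_subopen, safe)
  fix x y assume xy: "(x, y) \<in> mult_dom c1 c2 c3"
  define g h where "g = chart_inv c1 x" and "h = chart_inv c2 y"
  have gh: "x \<in> snd c1 ` fst c1" "y \<in> snd c2 ` fst c2" "g \<otimes> h \<in> fst c3" "g \<in> fst c1" "h \<in> fst c2"
    "snd c1 g = x" "snd c2 h = y"
    using xy unfolding mem_mult_dom_iff g_def h_def
    by (auto simp: chart_inv_in[OF mfd at(1)] chart_inv_in[OF mfd at(2)] chart_chart_inv[OF mfd at(1)]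
        chart_chart_inv[OF mfd at(2)])
  let ?P = "{p \<in> topspace (prod_topology (topol G) (topol G)). (\<lambda>(g, h). g \<otimes> h) p \<in> fst c3}"
  have "openin (prod_topology (topol G) (topol G)) ?P"
    by (rule openin_continuous_map_preimage[OF continuous_map_mult chart_openin[OF mfd at(3)]])
  moreover have "(g, h) \<in> ?P"
    using gh chart_carrier[OF at(1)] chart_carrier[OF at(2)] topspace by auto
  ultimately obtain S T where ST: "openin (topol G) S" "openin (topol G) T" "g \<in> S" "h \<in> T" "S \<times> T \<subseteq> ?P"
    unfolding openin_prod_topology_alt by meson
  let ?S = "snd c1 ` (S \<inter> fst c1)" and ?T = "snd c2 ` (T \<inter> fst c2)"
  have "open ?S" "open ?T"
    using ST chart_openin[OF mfd at(1)] chart_openin[OF mfd at(2)]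
    by (auto intro!: open_chart_image[OF mfd] at)
  then have "open (?S \<times> ?T)" by (rule open_Times)
  moreover have "(x, y) \<in> ?S \<times> ?T" using gh ST by auto
  moreover have "?S \<times> ?T \<subseteq> mult_dom c1 c2 c3"
    using ST(5) by (auto simp: mem_mult_dom_iff chart_inv_chart[OF mfd at(1)] chart_inv_chart[OF mfd at(2)])
  ultimately show "\<exists>T. open T \<and> (x, y) \<in> T \<and> T \<subseteq> mult_dom c1 c2 c3" by blast
qed

lemma mult_in_has_derivative:
  assumes "(x, y) \<in> mult_dom c1 c2 c3"
  shows "(mult_in c1 c2 c3 has_derivative frechet_derivative (mult_in c1 c2 c3) (at (x, y))) (at (x, y))"
  using smooth_on_differentiable[OF smooth_mult_in assms] frechet_derivative_works by blast

end

end

section \<open>First-order estimates at a point\<close>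

lemma has_derivative_zeroI:
  fixes g :: "'a::real_normed_vector \<Rightarrow> 'b::real_normed_vector"
  assumes "g x0 = 0" "\<And>\<epsilon>. \<epsilon> > 0 \<Longrightarrow> \<forall>\<^sub>F x in nhds x0. norm (g x) \<le> \<epsilon> * norm (x - x0)"
  shows "(g has_derivative (\<lambda>_. 0)) (at x0)"
  unfolding has_derivative_at_alt
proof (intro conjI allI impI)
  fix \<epsilon> :: real assume "\<epsilon> > 0"
  from assms(2)[OF this] show "\<exists>d>0. \<forall>y. norm (y - x0) < d \<longrightarrow> norm (g y - g x0 - 0) \<le> \<epsilon> * norm (y - x0)"
    unfolding eventually_nhds_metric by (auto simp: assms(1) dist_norm)
qed auto

lemma has_derivative_eventually_bound:
  fixes f :: "'a::real_normed_vector \<Rightarrow> 'b::real_normed_vector"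
  assumes "(f has_derivative f') (at x0)"
  obtains K where "K > 0" "\<forall>\<^sub>F x in nhds x0. norm (f x - f x0) \<le> K * norm (x - x0)"
proof -
  have bl: "bounded_linear f'" and *: "\<forall>\<^sub>F x in nhds x0. norm (f x - f x0 - f' (x - x0)) \<le> 1 * norm (x - x0)"
    using assms unfolding has_derivative_at_alt eventually_nhds_metric dist_norm
    by (blast, metis zero_less_one)
  have "\<forall>\<^sub>F x in nhds x0. norm (f x - f x0) \<le> (onorm f' + 1) * norm (x - x0)"
    using *
  proof eventually_elim
    case (elim x)
    have "norm (f x - f x0) \<le> norm (f x - f x0 - f' (x - x0)) + norm (f' (x - x0))"
      using norm_triangle_ineq[of "f x - f x0 - f' (x - x0)" "f' (x - x0)"] by simp
    then show ?case using elim onorm[OF bl, of "x - x0"] by (simp add: algebra_simps)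
  qed
  then show ?thesis using that[of "onorm f' + 1"] onorm_pos_le[OF bl] by auto
qed

text \<open>Implicit differentiation of \<open>A x (a x) = r x\<close> where \<open>A x\<close> tends to the identity; neither
  continuity of \<open>a\<close> nor invertibility of \<open>A x\<close> has to be assumed.\<close>

lemma has_derivative_near_identity:
  fixes A :: "'a::real_normed_vector \<Rightarrow> 'e::real_normed_vector \<Rightarrow> 'e"
  assumes B: "finite (B :: 'e set)" "span B = UNIV"
    and lin: "\<forall>\<^sub>F x in nhds x0. linear (A x)"
    and lim: "\<And>v. ((\<lambda>x. A x v) \<longlongrightarrow> v) (nhds x0)"
    and eq: "\<forall>\<^sub>F x in nhds x0. A x (a x) = r x"
    and der: "((\<lambda>x. r x - A x (a x0)) has_derivative f') (at x0)"
  shows "(a has_derivative f') (at x0)"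
proof -
  define u where "u x = a x - a x0" for x
  define f where "f x = r x - A x (a x0)" for x
  have small: "\<forall>\<^sub>F x in nhds x0. \<forall>v. norm (A x v - v) \<le> \<epsilon> * norm v" if "\<epsilon> > 0" for \<epsilon>
  proof (rule eventually_uniformly_small_finite_span[OF B _ _ that])
    show "\<forall>\<^sub>F x in nhds x0. linear (\<lambda>v. A x v - v)"
      using lin by eventually_elim (auto intro: linear_compose_sub linear_id[unfolded id_def])
    show "((\<lambda>x. A x v - v) \<longlongrightarrow> 0) (nhds x0)" for v
      using lim[of v] by (simp add: LIM_zero)
  qed
  have fu: "\<forall>\<^sub>F x in nhds x0. f x = A x (u x)"
    using lin eq by eventually_elim (simp add: f_def u_def linear_diff)
  have fx0: "f x0 = 0"
    using eventually_nhds_x_imp_x[OF fu] eventually_nhds_x_imp_x[OF lin] by (simp add: u_def linear_0)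
  obtain K where K: "K > 0" "\<forall>\<^sub>F x in nhds x0. norm (f x - f x0) \<le> K * norm (x - x0)"
    using has_derivative_eventually_bound[OF der] f_def by auto
  have uf: "((\<lambda>x. u x - f x) has_derivative (\<lambda>_. 0)) (at x0)"
  proof (rule has_derivative_zeroI)
    show "u x0 - f x0 = 0" by (simp add: u_def fx0)
    fix \<epsilon> :: real assume "\<epsilon> > 0"
    \<comment> \<open>When \<open>A x\<close> is within 1/2 of the identity,
      \<open>f x = A x (u x)\<close> forces norm (u x) \<le> 2 norm (f x) \<le> 2 K norm (x - x0).
      When it is within \<delta>, norm (u x - f x) \<le> \<delta> norm (u x), which this choice
      bounds by \<epsilon> norm (x - x0).\<close>
    define \<delta> where "\<delta> = \<epsilon> / (2 * K)"
    have \<delta>: "\<delta> > 0" using \<open>\<epsilon> > 0\<close> K(1) unfolding \<delta>_def by simp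
    show "\<forall>\<^sub>F x in nhds x0. norm (u x - f x) \<le> \<epsilon> * norm (x - x0)"
      using fu K(2) small[OF \<delta>] small[of "1/2", simplified]
    proof eventually_elim
      case (elim x)
      have "norm (u x) \<le> norm (A x (u x)) + norm (A x (u x) - u x)"
        using norm_triangle_ineq4[of "A x (u x)" "A x (u x) - u x"] by simp
      also have "norm (A x (u x) - u x) \<le> norm (u x) / 2" using elim(4) by auto
      finally have "norm (u x) \<le> 2 * norm (f x)" using elim(1) by simp
      then have "norm (u x) \<le> 2 * (K * norm (x - x0))" using elim(2) fx0 by simp
      then have "\<delta> * norm (u x) \<le> \<delta> * (2 * (K * norm (x - x0)))" using \<delta> by (intro mult_left_mono) auto
      also have "\<dots> = \<epsilon> * norm (x - x0)" using K(1) unfolding \<delta>_def by simp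
      finally have "\<delta> * norm (u x) \<le> \<epsilon> * norm (x - x0)" .
      moreover have "norm (u x - f x) \<le> \<delta> * norm (u x)"
        using elim(1,3) by (metis norm_minus_commute)
      ultimately show ?case by linarith
    qed
  qed
  have "((\<lambda>x. (u x - f x) + (f x + a x0)) has_derivative (\<lambda>h. 0 + (f' h + 0))) (at x0)"
    using der unfolding f_def[symmetric] by (intro has_derivative_add uf) auto
  then show ?thesis by (simp add: u_def)
qed

context lie_group_chart
begin

definition e0 :: 'e where "e0 = snd c \<one>"
definition \<Omega> :: "'e set" where "\<Omega> = snd c ` fst c"

abbreviation "\<psi> \<equiv> chart_inv c"
abbreviation "M \<equiv> mult_in c c c"
abbreviation "W \<equiv> mult_dom c c c"

lemma open_\<Omega>: "open \<Omega>" unfolding \<Omega>_def by (rule chart_range_open[OF mfd c_atlas])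

lemma e0_in: "e0 \<in> \<Omega>" unfolding \<Omega>_def e0_def using one_in_c by blast

lemma \<psi>_in: "x \<in> \<Omega> \<Longrightarrow> \<psi> x \<in> fst c"
  unfolding \<Omega>_def by (rule chart_inv_in[OF mfd c_atlas])

lemma \<psi>_carrier: "x \<in> \<Omega> \<Longrightarrow> \<psi> x \<in> carrier G"
  using \<psi>_in chart_carrier[OF c_atlas] by blast

lemma c_\<psi>: "x \<in> \<Omega> \<Longrightarrow> snd c (\<psi> x) = x"
  unfolding \<Omega>_def by (rule chart_chart_inv[OF mfd c_atlas])

lemma \<psi>_c: "g \<in> fst c \<Longrightarrow> \<psi> (snd c g) = g"
  by (rule chart_inv_chart[OF mfd c_atlas])

lemma \<psi>_e0: "\<psi> e0 = \<one>" unfolding e0_def by (rule \<psi>_c[OF one_in_c])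

lemma c_in: "g \<in> fst c \<Longrightarrow> snd c g \<in> \<Omega>" unfolding \<Omega>_def by blast

lemma M_eq: "x \<in> \<Omega> \<Longrightarrow> y \<in> \<Omega> \<Longrightarrow> M (x, y) = snd c (\<psi> x \<otimes> \<psi> y)"
  unfolding \<Omega>_def by (rule mult_in_eq[OF c_atlas c_atlas c_atlas])

lemma mem_W_iff: "(x, y) \<in> W \<longleftrightarrow> x \<in> \<Omega> \<and> y \<in> \<Omega> \<and> \<psi> x \<otimes> \<psi> y \<in> fst c"
  unfolding \<Omega>_def by (rule mem_mult_dom_iff[OF c_atlas c_atlas c_atlas])

lemma open_W: "open W" by (rule open_mult_dom[OF c_atlas c_atlas c_atlas])

lemma M_in: "(x, y) \<in> W \<Longrightarrow> M (x, y) \<in> \<Omega>"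
  by (auto simp: mem_W_iff M_eq c_in)

lemma \<psi>_M: "(x, y) \<in> W \<Longrightarrow> \<psi> (M (x, y)) = \<psi> x \<otimes> \<psi> y"
  by (auto simp: mem_W_iff M_eq \<psi>_c)

lemma W_e0: "x \<in> \<Omega> \<Longrightarrow> (x, e0) \<in> W" "x \<in> \<Omega> \<Longrightarrow> (e0, x) \<in> W"
  by (auto simp: mem_W_iff e0_in \<psi>_e0 \<psi>_in \<psi>_carrier)

lemma M_e0: "x \<in> \<Omega> \<Longrightarrow> M (x, e0) = x" "x \<in> \<Omega> \<Longrightarrow> M (e0, x) = x"
  by (auto simp: M_eq e0_in \<psi>_e0 \<psi>_carrier c_\<psi>)

lemma eventually_\<Omega>: "x \<in> \<Omega> \<Longrightarrow> \<forall>\<^sub>F y in nhds x. y \<in> \<Omega>"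
  using open_\<Omega> by (rule eventually_nhds_in_open)

section \<open>Conjugation and the adjoint map in coordinates\<close>

definition conj_in :: "'g \<Rightarrow> 'e \<Rightarrow> 'e" where
  "conj_in g x = snd c (inv g \<otimes> \<psi> x \<otimes> g)"

lemma Ad_eq: "Ad G c g = frechet_derivative (conj_in g) (at e0)"
  by (simp add: Ad_def conj_in_def[abs_def] e0_def)

text \<open>Neither g nor its inverse need lie in \<open>c\<close>. The product
  \<open>inv g \<otimes> \<psi> x\<close> is read in a chart \<open>d1\<close> around
  \<open>inv g\<close>, then multiplied by g, read in \<open>d2\<close>, with the result back in
  \<open>c\<close>. Near \<open>e0\<close> both coordinate products are defined and the chain rule
  applies.\<close>

lemma conj_in_near_one:
  assumes g: "g \<in> carrier G"
  shows "conj_in g differentiable (at e0)"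
    and "\<forall>\<^sub>F x in nhds e0. x \<in> \<Omega> \<and> inv g \<otimes> \<psi> x \<otimes> g \<in> fst c"
proof -
  obtain d1 where d1: "d1 \<in> atlas G" "inv g \<in> fst d1" using chart_around[of "inv g"] g by auto
  obtain d2 where d2: "d2 \<in> atlas G" "g \<in> fst d2" using chart_around[of g] g by auto
  define a b where "a = snd d1 (inv g)" and "b = snd d2 g"
  have inv_a: "chart_inv d1 a = inv g" and inv_b: "chart_inv d2 b = g"
    unfolding a_def b_def
    using chart_inv_chart[OF mfd d1(1) d1(2)] chart_inv_chart[OF mfd d2(1) d2(2)] by auto
  have b_in: "b \<in> snd d2 ` fst d2" unfolding b_def using d2(2) by blast
  define f where "f x = mult_in d1 c d1 (a, x)" for x
  have a_img: "a \<in> snd d1 ` fst d1" unfolding a_def using d1(2) by blast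
  have a_in: "(a, e0) \<in> mult_dom d1 c d1"
    using d1 g e0_in[unfolded \<Omega>_def]
    by (auto simp: mem_mult_dom_iff[OF d1(1) c_atlas d1(1)] inv_a \<psi>_e0 a_img)
  have f_e0: "f e0 = a"
    unfolding f_def using a_in g
    by (subst mult_in_eq[OF d1(1) c_atlas d1(1)])
      (auto simp: mem_mult_dom_iff[OF d1(1) c_atlas d1(1)] inv_a \<psi>_e0 simp flip: a_def)
  have fb_in: "(f e0, b) \<in> mult_dom d1 d2 c"
    using a_in b_in g one_in_c
    by (auto simp: mem_mult_dom_iff[OF d1(1) d2(1) c_atlas] mem_mult_dom_iff[OF d1(1) c_atlas d1(1)] inv_a inv_b f_e0)
  have df: "f differentiable (at e0)"
  proof -
    have "(mult_in d1 c d1 \<circ> (\<lambda>x. (a, x))) differentiable (at e0)"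
      using smooth_on_differentiable[OF smooth_mult_in[OF d1(1) c_atlas d1(1)] a_in]
      by (intro differentiable_chain_at) auto
    then show ?thesis by (simp add: f_def[abs_def] o_def)
  qed
  have dfb: "(\<lambda>x. (f x, b)) differentiable (at e0)"
    using df by (intro differentiable_Pair) auto
  have dF: "(\<lambda>x. mult_in d1 d2 c (f x, b)) differentiable (at e0)"
    using differentiable_chain_at[OF dfb smooth_on_differentiable[OF smooth_mult_in[OF d1(1) d2(1) c_atlas] fb_in]]
    by (simp add: o_def)
  have ev1: "\<forall>\<^sub>F x in nhds e0. (a, x) \<in> mult_dom d1 c d1"
    by (rule eventually_isCont_open[where f = "\<lambda>x. (a, x)",
          OF _ open_mult_dom[OF d1(1) c_atlas d1(1)] a_in])
      (intro continuous_intros)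
  have ev2: "\<forall>\<^sub>F x in nhds e0. (f x, b) \<in> mult_dom d1 d2 c"
    by (rule eventually_isCont_open[OF differentiable_imp_continuous_within[OF dfb]
          open_mult_dom[OF d1(1) d2(1) c_atlas] fb_in])
  have ev: "\<forall>\<^sub>F x in nhds e0. mult_in d1 d2 c (f x, b) = conj_in g x \<and> x \<in> \<Omega> \<and> inv g \<otimes> \<psi> x \<otimes> g \<in> fst c"
    using ev1 ev2
  proof eventually_elim
    case (elim x)
    have x: "x \<in> \<Omega>" "a \<in> snd d1 ` fst d1" "inv g \<otimes> \<psi> x \<in> fst d1"
      using elim(1) by (auto simp: mem_mult_dom_iff[OF d1(1) c_atlas d1(1)] \<Omega>_def inv_a)
    have "f x = snd d1 (inv g \<otimes> \<psi> x)"
      unfolding f_def using x by (subst mult_in_eq[OF d1(1) c_atlas d1(1)]) (auto simp: inv_a \<Omega>_def)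
    then have fx: "chart_inv d1 (f x) = inv g \<otimes> \<psi> x"
      using x(3) chart_inv_chart[OF mfd d1(1)] by simp
    have *: "f x \<in> snd d1 ` fst d1" "inv g \<otimes> \<psi> x \<otimes> g \<in> fst c"
      using elim(2) by (auto simp: mem_mult_dom_iff[OF d1(1) d2(1) c_atlas] fx inv_b)
    then show ?case
      using x(1) b_in by (simp add: mult_in_eq[OF d1(1) d2(1) c_atlas] fx inv_b conj_in_def)
  qed
  show "conj_in g differentiable (at e0)"
    by (rule differentiable_eventually_cong[OF dF]) (use ev in eventually_elim, auto)
  show "\<forall>\<^sub>F x in nhds e0. x \<in> \<Omega> \<and> inv g \<otimes> \<psi> x \<otimes> g \<in> fst c"
    using ev by eventually_elim auto
qed

lemma Ad_has_derivative: "g \<in> carrier G \<Longrightarrow> (conj_in g has_derivative Ad G c g) (at e0)"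
  using conj_in_near_one(1) frechet_derivative_works unfolding Ad_eq by blast

lemma conj_in_e0: "g \<in> carrier G \<Longrightarrow> conj_in g e0 = e0"
  by (simp add: conj_in_def \<psi>_e0) (simp add: e0_def)

lemma bounded_linear_Ad: "g \<in> carrier G \<Longrightarrow> bounded_linear (Ad G c g)"
  using Ad_has_derivative has_derivative_bounded_linear by blast

text \<open>Conjugating by \<open>g \<otimes> h\<close> is conjugating by g and then by h, because
  the inverse stands on the left; with this convention \<open>Ad\<close> reverses products.\<close>

lemma Ad_mult:
  assumes g: "g \<in> carrier G" and h: "h \<in> carrier G"
  shows "Ad G c (g \<otimes> h) v = Ad G c h (Ad G c g v)"
proof -
  have "((\<lambda>x. conj_in h (conj_in g x)) has_derivative (\<lambda>v. Ad G c h (Ad G c g v))) (at e0)"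
    using Ad_has_derivative[OF h] 
    by (intro has_derivative_compose[OF Ad_has_derivative[OF g]]) (simp add: conj_in_e0[OF g])
  moreover have "\<forall>\<^sub>F x in nhds e0. conj_in (g \<otimes> h) x = conj_in h (conj_in g x)"
    using conj_in_near_one(2)[OF g]
  proof eventually_elim
    case (elim x)
    then have "\<psi> (conj_in g x) = inv g \<otimes> \<psi> x \<otimes> g" by (simp add: conj_in_def \<psi>_c)
    then show ?case
      using elim by (simp add: conj_in_def[of h] conj_in_def[of "g \<otimes> h"] \<psi>_carrier g h inv_mult_group m_assoc)
  qed
  ultimately show ?thesis
    using has_derivative_eventually_unique[OF Ad_has_derivative[of "g \<otimes> h"]] g h by simp
qed

lemma Ad_one: "Ad G c \<one> v = v"
proof -
  have "\<forall>\<^sub>F x in nhds e0. conj_in \<one> x = x"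
    using eventually_\<Omega>[OF e0_in] by eventually_elim (simp add: conj_in_def \<psi>_carrier c_\<psi>)
  then show ?thesis
    using has_derivative_eventually_unique[OF Ad_has_derivative[OF one_closed] has_derivative_ident] by simp
qed

section \<open>Differentials of left and right translations\<close>

definition left_diff :: "'e \<Rightarrow> 'e \<Rightarrow> 'e" where
  "left_diff x v = frechet_derivative M (at (x, e0)) (0, v)"

text \<open>\<open>right_diff x\<close> and \<open>left_diff x\<close> are the R and L of the
  overview in coordinates. As partial derivatives of \<open>M\<close> with one argument at the
  identity they inherit smoothness in x.\<close>

definition right_diff :: "'e \<Rightarrow> 'e \<Rightarrow> 'e" where
  "right_diff x v = frechet_derivative M (at (e0, x)) (v, 0)"

lemma M_has_derivative: "(x, y) \<in> W \<Longrightarrow> (M has_derivative frechet_derivative M (at (x, y))) (at (x, y))"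
  by (rule mult_in_has_derivative[OF c_atlas c_atlas c_atlas])

lemma M_has_derivative_snd:
  "(x, y) \<in> W \<Longrightarrow> ((\<lambda>y. M (x, y)) has_derivative (\<lambda>v. frechet_derivative M (at (x, y)) (0, v))) (at y)"
  by (rule has_derivative_compose[of "\<lambda>y. (x, y)" "\<lambda>v. (0, v)" y UNIV M])
    (auto intro!: derivative_eq_intros M_has_derivative)

lemma M_has_derivative_fst:
  "(x, y) \<in> W \<Longrightarrow> ((\<lambda>x. M (x, y)) has_derivative (\<lambda>v. frechet_derivative M (at (x, y)) (v, 0))) (at x)"
  by (rule has_derivative_compose[of "\<lambda>x. (x, y)" "\<lambda>v. (v, 0)" x UNIV M])
    (auto intro!: derivative_eq_intros M_has_derivative)

lemma left_diff: "x \<in> \<Omega> \<Longrightarrow> ((\<lambda>y. M (x, y)) has_derivative left_diff x) (at e0)"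
  unfolding left_diff_def[abs_def] by (rule M_has_derivative_snd[OF W_e0(1)])

lemma right_diff: "x \<in> \<Omega> \<Longrightarrow> ((\<lambda>y. M (y, x)) has_derivative right_diff x) (at e0)"
  unfolding right_diff_def[abs_def] by (rule M_has_derivative_fst[OF W_e0(2)])

lemma linear_left_diff: "x \<in> \<Omega> \<Longrightarrow> linear (left_diff x)"
  using left_diff has_derivative_linear by blast

lemma linear_right_diff: "x \<in> \<Omega> \<Longrightarrow> linear (right_diff x)"
  using right_diff has_derivative_linear by blast

lemma left_diff_e0: "left_diff e0 v = v"
proof -
  have "\<forall>\<^sub>F x in nhds e0. M (e0, x) = x"
    using eventually_\<Omega>[OF e0_in] by eventually_elim (simp add: M_e0)
  then show ?thesis
    using has_derivative_eventually_unique[OF left_diff[OF e0_in] has_derivative_ident] by simp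
qed

lemma right_diff_e0: "right_diff e0 v = v"
proof -
  have "\<forall>\<^sub>F x in nhds e0. M (x, e0) = x"
    using eventually_\<Omega>[OF e0_in] by eventually_elim (simp add: M_e0)
  then show ?thesis
    using has_derivative_eventually_unique[OF right_diff[OF e0_in] has_derivative_ident] by simp
qed

text \<open>Differentiating \<open>x (x\<^sup>-\<^sup>1 y x) = y x\<close> in \<open>y\<close>.\<close>

lemma left_diff_Ad:
  assumes x: "x \<in> \<Omega>"
  shows "left_diff x (Ad G c (\<psi> x) v) = right_diff x v"
proof -
  note g = \<psi>_carrier[OF x]
  have "((\<lambda>y. M (x, conj_in (\<psi> x) y)) has_derivative (\<lambda>v. left_diff x (Ad G c (\<psi> x) v))) (at e0)"
    using left_diff[OF x]
    by (intro has_derivative_compose[OF Ad_has_derivative[OF g]]) (simp add: conj_in_e0[OF g])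
  moreover have "\<forall>\<^sub>F y in nhds e0. M (x, conj_in (\<psi> x) y) = M (y, x)"
    using conj_in_near_one(2)[OF g]
  proof eventually_elim
    case (elim y)
    have "\<psi> x \<otimes> (inv (\<psi> x) \<otimes> \<psi> y \<otimes> \<psi> x) = \<psi> y \<otimes> \<psi> x"
      using elim g by (simp add: \<psi>_carrier m_assoc flip: m_assoc[of "\<psi> x" "inv (\<psi> x)"])
    then show ?case
      using elim x by (simp add: M_eq conj_in_def c_in \<psi>_c)
  qed
  ultimately show ?thesis
    using has_derivative_eventually_unique[OF _ right_diff[OF x]] by metis
qed

text \<open>Differentiating \<open>(x y x\<^sup>-\<^sup>1) x = x y\<close> in \<open>y\<close>.\<close>

lemma right_diff_Ad_inv:
  assumes x: "x \<in> \<Omega>"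
  shows "right_diff x (Ad G c (inv (\<psi> x)) v) = left_diff x v"
proof -
  note g = inv_closed[OF \<psi>_carrier[OF x]]
  have "((\<lambda>y. M (conj_in (inv (\<psi> x)) y, x)) has_derivative (\<lambda>v. right_diff x (Ad G c (inv (\<psi> x)) v))) (at e0)"
    using right_diff[OF x]
    by (intro has_derivative_compose[OF Ad_has_derivative[OF g]]) (simp add: conj_in_e0[OF g])
  moreover have "\<forall>\<^sub>F y in nhds e0. M (conj_in (inv (\<psi> x)) y, x) = M (x, y)"
    using conj_in_near_one(2)[OF g]
  proof eventually_elim
    case (elim y)
    have "inv (inv (\<psi> x)) \<otimes> \<psi> y \<otimes> inv (\<psi> x) \<otimes> \<psi> x = \<psi> x \<otimes> \<psi> y"
      using elim \<psi>_carrier[OF x] by (simp add: \<psi>_carrier m_assoc)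
    then show ?case
      using elim x by (simp add: M_eq conj_in_def c_in \<psi>_c)
  qed
  ultimately show ?thesis
    using has_derivative_eventually_unique[OF _ left_diff[OF x]] by metis
qed

text \<open>Differentiating \<open>x (y z) = (x y) z\<close> in \<open>z\<close>: the fields \<open>x \<mapsto> left_diff x v\<close> are left invariant.\<close>

lemma left_diff_M:
  assumes xy: "(x, y) \<in> W"
  shows "frechet_derivative M (at (x, y)) (0, left_diff y v) = left_diff (M (x, y)) v"
proof -
  have x: "x \<in> \<Omega>" and y: "y \<in> \<Omega>" using xy by (auto simp: mem_W_iff)
  have "((\<lambda>z. M (x, M (y, z))) has_derivative (\<lambda>v. frechet_derivative M (at (x, y)) (0, left_diff y v))) (at e0)"
    using M_has_derivative_snd[OF xy]
    by (intro has_derivative_compose[OF left_diff[OF y]]) (simp add: M_e0[OF y])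
  moreover have "\<forall>\<^sub>F z in nhds e0. M (x, M (y, z)) = M (M (x, y), z)"
  proof -
    have "\<forall>\<^sub>F z in nhds e0. (y, z) \<in> W"
      by (rule eventually_isCont_open[where f = "\<lambda>z. (y, z)", OF _ open_W W_e0(1)[OF y]]) (intro continuous_intros)
    then show ?thesis
    proof eventually_elim
      case (elim z)
      then have z: "z \<in> \<Omega>" by (auto simp: mem_W_iff)
      show ?case
        using x y z elim xy by (simp add: M_eq[OF _ M_in] M_eq[OF M_in] \<psi>_M \<psi>_carrier m_assoc)
    qed
  qed
  ultimately show ?thesis
    using has_derivative_eventually_unique[OF _ left_diff[OF M_in[OF xy]]] by metis
qed

lemma smooth_M: "smooth_on W M" by (rule smooth_mult_in[OF c_atlas c_atlas c_atlas])

text \<open>\<open>left_diff x v\<close> is a directional derivative of the smooth \<open>M\<close>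
  along the slice of points \<open>(x, e0)\<close>, so it can be differentiated once more. Both
  conclusions feed the Lipschitz estimate for the left invariant field.\<close>

lemma left_diff_C1:
  assumes "x \<in> \<Omega>"
  shows "(\<lambda>x. left_diff x v) differentiable (at x)"
    and "continuous_on \<Omega> (\<lambda>x. frechet_derivative (\<lambda>x. left_diff x v) (at x) w)"
proof -
  let ?D = "\<lambda>p. frechet_derivative M (at p) (0, v)"
  have sm: "smooth_on W ?D" by (rule smooth_on_frechet_derivative[OF smooth_M])
  have der: "((\<lambda>x. left_diff x v) has_derivative (\<lambda>w. frechet_derivative ?D (at (x, e0)) (w, 0))) (at x)"
    if "x \<in> \<Omega>" for x
  proof -
    have "(?D has_derivative frechet_derivative ?D (at (x, e0))) (at (x, e0))"
      using smooth_on_differentiable[OF sm W_e0(1)[OF that]] frechet_derivative_works by blast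
    then show ?thesis unfolding left_diff_def
      by (rule has_derivative_compose[rotated]) (auto intro!: derivative_eq_intros)
  qed
  show "(\<lambda>x. left_diff x v) differentiable (at x)"
    using der[OF assms] unfolding differentiable_def by blast
  have eq: "frechet_derivative (\<lambda>x. left_diff x v) (at x) w = frechet_derivative ?D (at (x, e0)) (w, 0)"
    if "x \<in> \<Omega>" for x
    using frechet_derivative_at[OF der[OF that]] by metis
  have "continuous_on W (\<lambda>p. frechet_derivative ?D (at p) (w, 0))"
    by (rule smooth_on_continuous[OF smooth_on_frechet_derivative[OF sm]])
  then have "continuous_on \<Omega> (\<lambda>x. frechet_derivative ?D (at (x, e0)) (w, 0))"
    by (rule continuous_on_compose2) (auto intro!: continuous_intros W_e0)
  then show "continuous_on \<Omega> (\<lambda>x. frechet_derivative (\<lambda>x. left_diff x v) (at x) w)"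
    using eq by (simp cong: continuous_on_cong)
qed

lemma right_diff_differentiable:
  assumes "x \<in> \<Omega>"
  shows "(\<lambda>x. right_diff x v) differentiable (at x)"
proof -
  let ?D = "\<lambda>p. frechet_derivative M (at p) (v, 0)"
  have "?D differentiable (at (e0, x))"
    by (rule smooth_on_differentiable[OF smooth_on_frechet_derivative[OF smooth_M] W_e0(2)[OF assms]])
  then have "(?D \<circ> (\<lambda>x. (e0, x))) differentiable (at x)"
    by (intro differentiable_chain_at) auto
  then show ?thesis by (simp add: right_diff_def o_def)
qed

text \<open>The antisymmetrised mixed second derivative of \<open>M\<close> at the identity, that
  is, the bracket in coordinates. The form is the one differentiated in
  \<open>has_derivative_near_identity\<close>, where the value at the identity is
  \<open>Ad 1 \<eta> = \<eta>\<close>. Antisymmetry is not read off from second derivatives but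
  obtained through one-parameter subgroups in \<open>\<beta>_self\<close>.\<close>

definition \<beta> :: "'e \<Rightarrow> 'e \<Rightarrow> 'e" where
  "\<beta> \<xi> \<eta> = frechet_derivative (\<lambda>x. right_diff x \<eta> - left_diff x \<eta>) (at e0) \<xi>"

lemma \<beta>_has_derivative: "((\<lambda>x. right_diff x \<eta> - left_diff x \<eta>) has_derivative (\<lambda>\<xi>. \<beta> \<xi> \<eta>)) (at e0)"
proof -
  have "(\<lambda>x. right_diff x \<eta> - left_diff x \<eta>) differentiable (at e0)"
    by (intro differentiable_diff right_diff_differentiable left_diff_C1 e0_in)
  then show ?thesis unfolding \<beta>_def frechet_derivative_works by simp
qed

lemma linear_\<beta>1: "linear (\<lambda>\<xi>. \<beta> \<xi> \<eta>)"
  using \<beta>_has_derivative has_derivative_linear by blast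

lemma linear_\<beta>2: "linear (\<beta> \<xi>)"
proof (rule linearI)
  fix a b
  have "((\<lambda>x. right_diff x (a + b) - left_diff x (a + b)) has_derivative (\<lambda>\<xi>. \<beta> \<xi> a + \<beta> \<xi> b)) (at e0)"
  proof (rule has_derivative_transform_within_open[OF has_derivative_add[OF \<beta>_has_derivative \<beta>_has_derivative] open_\<Omega> e0_in])
    show "right_diff x a - left_diff x a + (right_diff x b - left_diff x b) =
        right_diff x (a + b) - left_diff x (a + b)" if "x \<in> \<Omega>" for x
      using linear_add[OF linear_left_diff[OF that]] linear_add[OF linear_right_diff[OF that]] by simp
  qed
  from has_derivative_unique[OF this \<beta>_has_derivative]
  show "\<beta> \<xi> (a + b) = \<beta> \<xi> a + \<beta> \<xi> b" by metis
next
  fix r a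
  have "((\<lambda>x. right_diff x (r *\<^sub>R a) - left_diff x (r *\<^sub>R a)) has_derivative (\<lambda>\<xi>. r *\<^sub>R \<beta> \<xi> a)) (at e0)"
  proof (rule has_derivative_transform_within_open[OF has_derivative_scaleR_right[OF \<beta>_has_derivative] open_\<Omega> e0_in])
    show "r *\<^sub>R (right_diff x a - left_diff x a) = right_diff x (r *\<^sub>R a) - left_diff x (r *\<^sub>R a)"
      if "x \<in> \<Omega>" for x
      using linear_scale[OF linear_left_diff[OF that]] linear_scale[OF linear_right_diff[OF that]]
      by (simp add: scaleR_diff_right)
  qed
  from has_derivative_unique[OF this \<beta>_has_derivative]
  show "\<beta> \<xi> (r *\<^sub>R a) = r *\<^sub>R \<beta> \<xi> a" by metis
qed

lemma left_diff_tendsto: "((\<lambda>x. left_diff x v) \<longlongrightarrow> v) (nhds e0)"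
  using differentiable_imp_continuous_within[OF left_diff_C1(1)[OF e0_in, of v]]
    tendsto_at_iff_tendsto_nhds[of "\<lambda>x. left_diff x v" e0]
  by (simp add: continuous_within left_diff_e0)

lemma right_diff_tendsto: "((\<lambda>x. right_diff x v) \<longlongrightarrow> v) (nhds e0)"
  using differentiable_imp_continuous_within[OF right_diff_differentiable[OF e0_in, of v]]
    tendsto_at_iff_tendsto_nhds[of "\<lambda>x. right_diff x v" e0]
  by (simp add: continuous_within right_diff_e0)

lemma Ad_chart_has_derivative: "((\<lambda>x. Ad G c (\<psi> x) \<eta>) has_derivative (\<lambda>\<xi>. \<beta> \<xi> \<eta>)) (at e0)"
proof -
  obtain B :: "'e set" where B: "finite B" "span B = UNIV" by (rule finite_span)
  show ?thesis
  proof (rule has_derivative_near_identity[OF B])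
    show "\<forall>\<^sub>F x in nhds e0. linear (left_diff x)"
      using eventually_\<Omega>[OF e0_in] by eventually_elim (rule linear_left_diff)
    show "\<forall>\<^sub>F x in nhds e0. left_diff x (Ad G c (\<psi> x) \<eta>) = right_diff x \<eta>"
      using eventually_\<Omega>[OF e0_in] by eventually_elim (rule left_diff_Ad)
  qed (simp_all add: left_diff_tendsto \<psi>_e0 Ad_one \<beta>_has_derivative)
qed

text \<open>Now \<open>right_diff x\<close> is the family tending to the identity and
  \<open>left_diff x \<eta>\<close> the right-hand side; exchanging the two translations produces
  the minus sign.\<close>

lemma Ad_chart_inv_has_derivative:
  "((\<lambda>x. Ad G c (inv (\<psi> x)) \<eta>) has_derivative (\<lambda>\<xi>. - \<beta> \<xi> \<eta>)) (at e0)"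
proof -
  obtain B :: "'e set" where B: "finite B" "span B = UNIV" by (rule finite_span)
  show ?thesis
  proof (rule has_derivative_near_identity[OF B])
    show "\<forall>\<^sub>F x in nhds e0. linear (right_diff x)"
      using eventually_\<Omega>[OF e0_in] by eventually_elim (rule linear_right_diff)
    show "\<forall>\<^sub>F x in nhds e0. right_diff x (Ad G c (inv (\<psi> x)) \<eta>) = left_diff x \<eta>"
      using eventually_\<Omega>[OF e0_in] by eventually_elim (rule right_diff_Ad_inv)
    show "((\<lambda>x. left_diff x \<eta> - right_diff x (Ad G c (inv (\<psi> e0)) \<eta>)) has_derivative (\<lambda>\<xi>. - \<beta> \<xi> \<eta>)) (at e0)"
      using has_derivative_minus[OF \<beta>_has_derivative, of \<eta>] by (simp add: \<psi>_e0 Ad_one)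
  qed (simp_all add: right_diff_tendsto)
qed

end

section \<open>One-parameter subgroups\<close>

context lie_group_chart
begin

text \<open>Continuity is available for the directional derivatives of the field. Bounding them near
  \<open>e0\<close> at the finitely many vectors of \<open>C\<close> bounds the whole differential,
  and the mean value inequality on a convex ball gives the Lipschitz constant.\<close>

lemma left_diff_lipschitz:
  obtains r L where "r > 0" "L \<ge> 0" "cball e0 r \<subseteq> \<Omega>"
    "\<And>x y. x \<in> cball e0 r \<Longrightarrow> y \<in> cball e0 r \<Longrightarrow>
       norm (left_diff x v - left_diff y v) \<le> L * norm (x - y)"
proof -
  obtain B :: "'e set" where B: "finite B" "span B = UNIV" by (rule finite_span)
  obtain C k where C: "finite C" "k > 0"
    "\<And>f :: 'e \<Rightarrow> 'e. \<And>\<epsilon> v. linear f \<Longrightarrow> (\<And>b. b \<in> C \<Longrightarrow> norm (f b) \<le> \<epsilon>)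
       \<Longrightarrow> 0 \<le> \<epsilon> \<Longrightarrow> norm (f v) \<le> k * \<epsilon> * norm v"
    using pointwise_bound_finite_span[OF B, where 'f = 'e] by metis
  define D where "D x w = frechet_derivative (\<lambda>x. left_diff x v) (at x) w" for x w
  \<comment> \<open>Strictly above \<open>norm (D e0 b)\<close> for each b in \<open>C\<close>, so
    that continuity preserves the bound near \<open>e0\<close>.\<close>
  define \<epsilon> where "\<epsilon> = (\<Sum>b\<in>C. norm (D e0 b)) + 1"
  have \<epsilon>: "\<epsilon> \<ge> 0" unfolding \<epsilon>_def by (simp add: sum_nonneg add_nonneg_nonneg)
  have "\<forall>\<^sub>F x in nhds e0. norm (D x b) < \<epsilon>" if b: "b \<in> C" for b
  proof -
    have "isCont (\<lambda>x. D x b) e0"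
      using left_diff_C1(2)[OF e0_in] open_\<Omega> e0_in unfolding D_def
      by (simp add: continuous_on_eq_continuous_at)
    then have "isCont (\<lambda>x. norm (D x b)) e0" by (intro continuous_intros)
    moreover have "norm (D e0 b) < \<epsilon>"
      unfolding \<epsilon>_def using member_le_sum[OF b, of "\<lambda>b. norm (D e0 b)"] C(1) by simp
    ultimately have "\<forall>\<^sub>F x in nhds e0. norm (D x b) \<in> {..<\<epsilon>}"
      by (intro eventually_isCont_open) auto
    then show ?thesis by simp
  qed
  then have "\<forall>\<^sub>F x in nhds e0. (\<forall>b\<in>C. norm (D x b) < \<epsilon>) \<and> x \<in> \<Omega>"
    using eventually_\<Omega>[OF e0_in] C(1) by (intro eventually_conj eventually_ball_finite) auto
  then obtain s where s: "s > 0" "\<And>x. dist x e0 < s \<Longrightarrow> (\<forall>b\<in>C. norm (D x b) < \<epsilon>) \<and> x \<in> \<Omega>"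
    unfolding eventually_nhds_metric by auto
  have near: "(\<forall>b\<in>C. norm (D x b) < \<epsilon>)" "x \<in> \<Omega>" if "x \<in> cball e0 (s / 2)" for x
    using s(2)[of x] that s(1) by (auto simp: dist_commute)
  have der: "((\<lambda>x. left_diff x v) has_derivative D x) (at x)" if "x \<in> \<Omega>" for x
    using left_diff_C1(1)[OF that] unfolding D_def[abs_def] frechet_derivative_works by simp
  show ?thesis
  proof (rule that[of "s / 2" "k * \<epsilon>"])
    fix x y assume "x \<in> cball e0 (s / 2)" "y \<in> cball e0 (s / 2)"
    then show "norm (left_diff x v - left_diff y v) \<le> k * \<epsilon> * norm (x - y)"
    proof (intro differentiable_bound[of "cball e0 (s / 2)"])
      fix x assume x: "x \<in> cball e0 (s / 2)"
      show "((\<lambda>x. left_diff x v) has_derivative D x) (at x within cball e0 (s / 2))"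
        using der[OF near(2)[OF x]] has_derivative_at_withinI by blast
      show "onorm (D x) \<le> k * \<epsilon>"
      proof (rule onorm_bound)
        show "0 \<le> k * \<epsilon>" using C(2) \<epsilon> by simp
        show "norm (D x w) \<le> k * \<epsilon> * norm w" for w
          using near(1)[OF x] by (intro C(3) has_derivative_linear[OF der[OF near(2)[OF x]]] \<epsilon>) (simp add: less_imp_le)
      qed
    qed auto
  qed (use s C(2) \<epsilon> near(2) in auto)
qed

lemma one_parameter_subgroup_one:
  assumes "one_parameter_subgroup G c \<xi> \<gamma>" shows "\<gamma> 0 = \<one>"
proof -
  have "\<gamma> 0 = \<gamma> 0 \<otimes> \<gamma> 0" "\<gamma> 0 \<in> carrier G"
    using assms unfolding one_parameter_subgroup_def by (metis add.right_neutral, blast)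
  then show ?thesis by (metis l_cancel_one)
qed

lemma one_parameter_subgroup_pow:
  assumes "one_parameter_subgroup G c \<xi> \<gamma>" shows "\<gamma> (real n * t) = \<gamma> t [^] n"
proof (induction n)
  case 0
  then show ?case using one_parameter_subgroup_one[OF assms] by simp
next
  case (Suc n)
  have "\<gamma> (real (Suc n) * t) = \<gamma> (real n * t + t)" by (simp add: algebra_simps)
  then show ?case using Suc assms unfolding one_parameter_subgroup_def by simp
qed

lemma one_parameter_subgroup_near_zero:
  assumes \<gamma>: "one_parameter_subgroup G c \<xi> \<gamma>"
  shows "\<forall>\<^sub>F t in nhds 0. \<gamma> t \<in> fst c"
    and "((\<lambda>t. snd c (\<gamma> t)) has_derivative (\<lambda>h. h *\<^sub>R \<xi>)) (at 0)"
    and "isCont (\<lambda>t. snd c (\<gamma> t)) 0"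
proof -
  have cont: "continuous_map euclideanreal (topol G) \<gamma>"
    using \<gamma> unfolding one_parameter_subgroup_def by blast
  have "open {t. \<gamma> t \<in> fst c}"
    using openin_continuous_map_preimage[OF cont chart_openin[OF mfd c_atlas]] by simp
  then show "\<forall>\<^sub>F t in nhds 0. \<gamma> t \<in> fst c"
    using eventually_nhds_in_open[of "{t. \<gamma> t \<in> fst c}" 0] one_in_c one_parameter_subgroup_one[OF \<gamma>]
    by simp
  show "((\<lambda>t. snd c (\<gamma> t)) has_derivative (\<lambda>h. h *\<^sub>R \<xi>)) (at 0)"
    using \<gamma> unfolding one_parameter_subgroup_def has_vector_derivative_def by blast
  then show "isCont (\<lambda>t. snd c (\<gamma> t)) 0" by (rule has_derivative_continuous)
qed

text \<open>The definition gives a derivative at time 0 only. Near s the curve is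
  \<open>\<gamma> s\<close> times its piece near 0, and left translation carries the derivative
  along.\<close>

lemma one_parameter_subgroup_ode:
  assumes \<gamma>: "one_parameter_subgroup G c \<xi> \<gamma>" and s: "\<gamma> s \<in> fst c"
  shows "((\<lambda>t. snd c (\<gamma> t)) has_vector_derivative left_diff (snd c (\<gamma> s)) \<xi>) (at s)"
proof -
  let ?y = "\<lambda>t. snd c (\<gamma> t)"
  have ys: "?y s \<in> \<Omega>" using s by (rule c_in)
  have "?y 0 = e0" using one_parameter_subgroup_one[OF \<gamma>] by (simp add: e0_def)
  then have "((\<lambda>t. M (?y s, ?y t)) has_derivative (\<lambda>h. left_diff (?y s) (h *\<^sub>R \<xi>))) (at 0)"
    using left_diff[OF ys] by (intro has_derivative_compose[OF one_parameter_subgroup_near_zero(2)[OF \<gamma>]]) simp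
  moreover have "\<forall>\<^sub>F t in nhds 0. M (?y s, ?y t) = ?y (s + t)"
    using one_parameter_subgroup_near_zero(1)[OF \<gamma>]
  proof eventually_elim
    case (elim t)
    then show ?case
      using s \<gamma> by (simp add: M_eq c_in \<psi>_c one_parameter_subgroup_def)
  qed
  ultimately have "((\<lambda>t. ?y (s + t)) has_derivative (\<lambda>h. left_diff (?y s) (h *\<^sub>R \<xi>))) (at 0)"
    using has_derivative_transform_eventually[of "\<lambda>t. M (?y s, ?y t)" _ 0 UNIV "\<lambda>t. ?y (s + t)"]
    by (auto simp: eventually_nhds_conv_at)
  moreover have "((\<lambda>t. t - s) has_derivative (\<lambda>h. h)) (at s)" by (auto intro!: derivative_eq_intros)
  ultimately have "((\<lambda>t. ?y (s + (t - s))) has_derivative (\<lambda>h. left_diff (?y s) (h *\<^sub>R \<xi>))) (at s)"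
    by (intro has_derivative_compose[of "\<lambda>t. t - s" "\<lambda>h. h" s UNIV "\<lambda>t. ?y (s + t)"]) auto
  then show ?thesis
    by (simp add: has_vector_derivative_def linear_scale[OF linear_left_diff[OF ys]])
qed

text \<open>In the chart both curves solve the equation of the same left invariant field, so they
  agree for short times; any t is n times a short time t / n, and both values are n-th
  powers.\<close>

lemma one_parameter_subgroup_unique:
  assumes \<gamma>: "one_parameter_subgroup G c \<xi> \<gamma>" and \<gamma>': "one_parameter_subgroup G c \<xi> \<gamma>'"
  shows "\<gamma> = \<gamma>'"
proof
  fix t
  obtain r L where rL: "r > 0" "L \<ge> 0" "cball e0 r \<subseteq> \<Omega>"
    "\<And>x y. x \<in> cball e0 r \<Longrightarrow> y \<in> cball e0 r \<Longrightarrow>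
       norm (left_diff x \<xi> - left_diff y \<xi>) \<le> L * norm (x - y)"
    using left_diff_lipschitz[of \<xi>] by metis
  have near: "\<forall>\<^sub>F t in nhds 0. \<gamma> t \<in> fst c \<and> snd c (\<gamma> t) \<in> ball e0 r"
    if \<gamma>: "one_parameter_subgroup G c \<xi> \<gamma>" for \<gamma>
  proof (intro eventually_conj one_parameter_subgroup_near_zero(1)[OF that])
    show "\<forall>\<^sub>F t in nhds 0. snd c (\<gamma> t) \<in> ball e0 r"
      by (rule eventually_isCont_open[OF one_parameter_subgroup_near_zero(3)[OF that]])
        (use rL(1) one_parameter_subgroup_one[OF that] in \<open>auto simp: e0_def\<close>)
  qed
  have "\<forall>\<^sub>F t in nhds 0. (\<gamma> t \<in> fst c \<and> snd c (\<gamma> t) \<in> ball e0 r) \<and> (\<gamma>' t \<in> fst c \<and> snd c (\<gamma>' t) \<in> ball e0 r)"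
    by (intro eventually_conj near \<gamma> \<gamma>')
  then obtain d where d: "d > 0" "\<And>t. \<bar>t\<bar> < d \<Longrightarrow> \<gamma> t \<in> fst c \<and> snd c (\<gamma> t) \<in> ball e0 r \<and>
      \<gamma>' t \<in> fst c \<and> snd c (\<gamma>' t) \<in> ball e0 r"
    unfolding eventually_nhds_metric by (auto simp: dist_real_def)
  \<comment> \<open>Half of d keeps both curves in the chart and the ball; the other entry gives
    \<open>L * \<delta> < 1\<close> for \<open>autonomous_ode_unique\<close>.\<close>
  define \<delta> where "\<delta> = min (d / 2) (1 / (2 * (L + 1)))"
  have \<delta>: "\<delta> > 0" "\<delta> < d" unfolding \<delta>_def using d(1) rL(2) by auto
  have "L * \<delta> \<le> L * (1 / (2 * (L + 1)))" unfolding \<delta>_def using rL(2) by (intro mult_left_mono) auto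
  also have "\<dots> < 1" using rL(2) by (simp add: divide_simps)
  finally have L\<delta>: "L * \<delta> < 1" .
  have eq: "\<gamma> u = \<gamma>' u" if u: "u \<in> {-\<delta>..\<delta>}" for u
  proof -
    have "snd c (\<gamma> u) = snd c (\<gamma>' u)"
    proof (rule autonomous_ode_unique[where S = "cball e0 r" and V = "\<lambda>x. left_diff x \<xi>"
          and L = L and d = \<delta>])
      fix t assume "t \<in> {-\<delta>..\<delta>}"
      with \<delta> have t: "\<bar>t\<bar> < d" by auto
      show "snd c (\<gamma> t) \<in> cball e0 r" "snd c (\<gamma>' t) \<in> cball e0 r" using d(2)[OF t] by auto
      show "((\<lambda>u. snd c (\<gamma> u)) has_vector_derivative left_diff (snd c (\<gamma> t)) \<xi>) (at t within {-\<delta>..\<delta>})"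
        "((\<lambda>u. snd c (\<gamma>' u)) has_vector_derivative left_diff (snd c (\<gamma>' t)) \<xi>) (at t within {-\<delta>..\<delta>})"
        using d(2)[OF t] has_vector_derivative_at_within[OF one_parameter_subgroup_ode[OF \<gamma>]]
          has_vector_derivative_at_within[OF one_parameter_subgroup_ode[OF \<gamma>']] by blast+
    qed (use rL u L\<delta> one_parameter_subgroup_one[OF \<gamma>] one_parameter_subgroup_one[OF \<gamma>'] in auto)
    moreover have "\<gamma> u \<in> fst c" "\<gamma>' u \<in> fst c" using d(2)[of u] u \<delta> by auto
    ultimately show ?thesis using \<psi>_c by metis
  qed
  obtain n :: nat where n: "\<bar>t\<bar> / \<delta> < real n" using reals_Archimedean2 by blast
  with \<delta> have "real n > 0" by (meson abs_ge_zero divide_nonneg_pos le_less_trans)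
  then have "t / real n \<in> {-\<delta>..\<delta>}" using n \<delta> by (auto simp: field_simps abs_if split: if_splits)
  from eq[OF this] have "\<gamma> (real n * (t / real n)) = \<gamma>' (real n * (t / real n))"
    using one_parameter_subgroup_pow[OF \<gamma>] one_parameter_subgroup_pow[OF \<gamma>'] by metis
  then show "\<gamma> t = \<gamma>' t" using \<open>real n > 0\<close> by simp
qed

text \<open>x is the integral curve of the left invariant field through \<open>e0\<close>. For fixed
  s, both x (s + t) and the product of x s with x t solve the same equation in t with the same value
  at t = 0, hence coincide.\<close>

lemma local_one_parameter_subgroup:
  obtains x \<delta> where "\<delta> > 0" "x 0 = e0" "(x has_vector_derivative \<xi>) (at 0)"
    "\<And>t. \<bar>t\<bar> \<le> \<delta> \<Longrightarrow> x t \<in> \<Omega>" "continuous_on {-\<delta>..\<delta>} x"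
    "\<And>s t. \<bar>s\<bar> \<le> \<delta> \<Longrightarrow> \<bar>t\<bar> \<le> \<delta> \<Longrightarrow> \<psi> (x (s + t)) = \<psi> (x s) \<otimes> \<psi> (x t)"
proof -
  obtain r L where rL: "r > 0" "L \<ge> 0" "cball e0 r \<subseteq> \<Omega>"
    "\<And>x y. x \<in> cball e0 r \<Longrightarrow> y \<in> cball e0 r \<Longrightarrow>
       norm (left_diff x \<xi> - left_diff y \<xi>) \<le> L * norm (x - y)"
    using left_diff_lipschitz[of \<xi>] by metis
  obtain d x where dx: "d > 0" "x 0 = e0" "\<And>t. t \<in> {-d..d} \<Longrightarrow> x t \<in> cball e0 r"
    "\<And>t. t \<in> {-d..d} \<Longrightarrow> (x has_vector_derivative left_diff (x t) \<xi>) (at t within {-d..d})"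
    using autonomous_ode_exists[OF rL(1,2,4)] by blast
  have der: "(x has_vector_derivative left_diff (x t) \<xi>) (at t)" if "\<bar>t\<bar> < d" for t
    using dx(4)[of t] at_within_interior[of t "{-d..d}"] that
    by (simp add: interior_atLeastAtMost_real abs_less_iff)
  have x\<Omega>: "x t \<in> \<Omega>" if "\<bar>t\<bar> < d" for t using dx(3)[of t] rL(3) that by (auto simp: abs_less_iff less_imp_le)
  have "isCont M (e0, e0)"
    using has_derivative_continuous[OF M_has_derivative[OF W_e0(1)[OF e0_in]]] .
  then have "\<forall>\<^sub>F p in nhds (e0, e0). M p \<in> ball e0 r"
    by (rule eventually_isCont_open) (use rL(1) in \<open>auto simp: M_e0 e0_in\<close>)
  moreover have "\<forall>\<^sub>F p in nhds (e0, e0). p \<in> W"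
    using open_W W_e0(1)[OF e0_in] by (rule eventually_nhds_in_open)
  ultimately have "\<forall>\<^sub>F p in nhds e0 \<times>\<^sub>F nhds e0. M p \<in> ball e0 r \<and> p \<in> W"
    unfolding nhds_prod[symmetric] by eventually_elim auto
  \<comment> \<open>Neighbourhoods of \<open>e0\<close> whose products are defined in the chart and
    fall into the ball where the Lipschitz bound holds.\<close>
  then obtain P Q where PQ: "eventually P (nhds e0)" "eventually Q (nhds e0)"
    "\<And>a b. P a \<Longrightarrow> Q b \<Longrightarrow> M (a, b) \<in> ball e0 r \<and> (a, b) \<in> W"
    unfolding eventually_prod_filter by blast
  have "isCont x 0" using der[of 0] dx(1) has_vector_derivative_continuous by fastforce
  then have "(x \<longlongrightarrow> e0) (nhds 0)" using dx(2) tendsto_at_iff_tendsto_nhds[of x 0] by (simp add: isCont_def)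
  then have "\<forall>\<^sub>F t in nhds 0. P (x t) \<and> Q (x t)"
    using PQ(1,2) by (auto simp: filterlim_iff intro: eventually_conj)
  then obtain \<rho> where \<rho>: "\<rho> > 0" "\<And>t. \<bar>t\<bar> < \<rho> \<Longrightarrow> P (x t) \<and> Q (x t)"
    unfolding eventually_nhds_metric by (auto simp: dist_real_def)
  \<comment> \<open>\<open>d / 4\<close> keeps s + t inside the interval of existence,
    \<open>\<rho> / 2\<close> keeps the factors in the neighbourhoods just found, and the last entry
    serves uniqueness.\<close>
  define \<delta> where "\<delta> = min (min (d / 4) (\<rho> / 2)) (1 / (2 * (L + 1)))"
  have \<delta>: "\<delta> > 0" "2 * \<delta> < d" "\<delta> < \<rho>" unfolding \<delta>_def using dx(1) rL(2) \<rho>(1) by auto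
  have "L * \<delta> \<le> L * (1 / (2 * (L + 1)))" unfolding \<delta>_def using rL(2) by (intro mult_left_mono) auto
  also have "\<dots> < 1" using rL(2) by (simp add: divide_simps)
  finally have L\<delta>: "L * \<delta> < 1" .
  have hom: "\<psi> (x (s + t)) = \<psi> (x s) \<otimes> \<psi> (x t)" if s: "\<bar>s\<bar> \<le> \<delta>" and t: "\<bar>t\<bar> \<le> \<delta>" for s t
  proof -
    have MW: "M (x s, x u) \<in> ball e0 r" "(x s, x u) \<in> W" if "\<bar>u\<bar> \<le> \<delta>" for u
      using PQ(3) \<rho>(2) s that \<delta>(3) by auto
    have "x (s + t) = M (x s, x t)"
    proof (rule autonomous_ode_unique[where S = "cball e0 r" and V = "\<lambda>x. left_diff x \<xi>"
          and L = L and d = \<delta>])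
      fix u assume "u \<in> {-\<delta>..\<delta>}"
      then have u: "\<bar>u\<bar> \<le> \<delta>" "\<bar>s + u\<bar> < d" "\<bar>u\<bar> < d" using s \<delta> by auto
      show "x (s + u) \<in> cball e0 r" using u dx(3)[of "s + u"] by (simp add: abs_less_iff less_imp_le)
      show "M (x s, x u) \<in> cball e0 r" using MW[OF u(1)] by auto
      have "((x \<circ> (\<lambda>t. s + t)) has_vector_derivative (1 *\<^sub>R left_diff (x (s + u)) \<xi>)) (at u)"
        by (rule vector_diff_chain_at) (auto intro!: derivative_eq_intros der u)
      then show "((\<lambda>t. x (s + t)) has_vector_derivative left_diff (x (s + u)) \<xi>) (at u within {-\<delta>..\<delta>})"
        by (auto simp: o_def intro: has_vector_derivative_at_within)
      have "((\<lambda>t. M (x s, x t)) has_derivative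
          (\<lambda>h. frechet_derivative M (at (x s, x u)) (0, h *\<^sub>R left_diff (x u) \<xi>))) (at u)"
        by (rule has_derivative_compose[OF der[OF u(3), unfolded has_vector_derivative_def]
              M_has_derivative_snd[OF MW(2)[OF u(1)]]])
      moreover have "frechet_derivative M (at (x s, x u)) (0, h *\<^sub>R left_diff (x u) \<xi>) =
          h *\<^sub>R left_diff (M (x s, x u)) \<xi>" for h
        using left_diff_M[OF MW(2)[OF u(1)], of \<xi>]
          linear_scale[OF has_derivative_linear[OF M_has_derivative_snd[OF MW(2)[OF u(1)]]]]
        by simp
      ultimately show "((\<lambda>t. M (x s, x t)) has_vector_derivative left_diff (M (x s, x u)) \<xi>)
          (at u within {-\<delta>..\<delta>})"
        by (auto simp: has_vector_derivative_def intro: has_derivative_at_withinI)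
    next
      show "x (s + 0) = M (x s, x 0)" using dx(2) M_e0(1)[OF x\<Omega>, of s] s \<delta> by simp
    qed (use rL L\<delta> t in auto)
    then show ?thesis using \<psi>_M[OF MW(2)[OF t]] by simp
  qed
  show ?thesis
  proof (rule that[of \<delta> x])
    show "(x has_vector_derivative \<xi>) (at 0)" using der[of 0] dx(1,2) by (simp add: left_diff_e0)
    show "continuous_on {-\<delta>..\<delta>} x"
      by (rule continuous_on_vector_derivative[of _ _ "\<lambda>t. left_diff (x t) \<xi>"])
        (use \<delta> in \<open>auto intro!: has_vector_derivative_at_within der\<close>)
  qed (use \<delta> dx x\<Omega> hom in auto)
qed

lemma continuous_map_nat_pow: "continuous_map (topol G) (topol G) (\<lambda>g. g [^] (n::nat))"
proof (induction n)
  case 0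
  have "\<one> \<in> topspace (topol G)" by (simp add: topspace)
  then show ?case by simp
next
  case (Suc n)
  have "continuous_map (topol G) (prod_topology (topol G) (topol G)) (\<lambda>g. (g [^] n, g))"
    using Suc by (simp add: continuous_map_paired)
  from continuous_map_compose[OF this continuous_map_mult] show ?case by (simp add: o_def)
qed

text \<open>A local one-parameter subgroup \<open>g\<close> extends by \<open>t \<mapsto> g (t / n)\<^sup>n\<close> for large \<open>n\<close>.\<close>

lemma extend_local_homomorphism:
  fixes g :: "real \<Rightarrow> 'g"
  assumes "\<delta> > 0" and car: "\<And>t. \<bar>t\<bar> \<le> \<delta> \<Longrightarrow> g t \<in> carrier G" and one: "g 0 = \<one>"
    and hom: "\<And>s t. \<bar>s\<bar> \<le> \<delta> \<Longrightarrow> \<bar>t\<bar> \<le> \<delta> \<Longrightarrow> g (s + t) = g s \<otimes> g t"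
    and cont: "continuous_map (top_of_set {-\<delta>..\<delta>}) (topol G) g"
  obtains \<gamma> where "\<And>t. \<gamma> t \<in> carrier G" "\<And>s t. \<gamma> (s + t) = \<gamma> s \<otimes> \<gamma> t"
    "continuous_map euclideanreal (topol G) \<gamma>" "\<And>t. \<bar>t\<bar> \<le> \<delta> \<Longrightarrow> \<gamma> t = g t"
proof -
  have pow: "g (real m * u) = g u [^] m" if "real m * \<bar>u\<bar> \<le> \<delta>" for m u
    using that
  proof (induction m)
    case 0 then show ?case using one by simp
  next
    case (Suc m)
    have "\<bar>u\<bar> + real m * \<bar>u\<bar> \<le> \<delta>"
      using Suc.prems unfolding of_nat_Suc distrib_right mult_1_left by (simp add: add.commute)
    moreover have "0 \<le> real m * \<bar>u\<bar>" "0 \<le> \<bar>u\<bar>" by simp_all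
    ultimately have m: "real m * \<bar>u\<bar> \<le> \<delta>" and "\<bar>u\<bar> \<le> \<delta>" by linarith+
    note this(2)
    moreover have "\<bar>real m * u\<bar> \<le> \<delta>" using m by (simp add: abs_mult)
    ultimately have "g (real m * u + u) = g (real m * u) \<otimes> g u" by (intro hom)
    then show ?case using Suc.IH[OF m] by (simp add: algebra_simps)
  qed
  \<comment> \<open>Both sides equal the value of \<open>g\<close> at t / (n m) to the power n
    m.\<close>
  have indep: "g (t / real n) [^] n = g (t / real m) [^] m"
    if n: "n > 0" "\<bar>t\<bar> \<le> real n * \<delta>" and m: "m > 0" "\<bar>t\<bar> \<le> real m * \<delta>" for t and n m :: nat
  proof -
    let ?u = "t / (real n * real m)"
    have *: "real m * \<bar>?u\<bar> \<le> \<delta>" "real n * \<bar>?u\<bar> \<le> \<delta>"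
      using n m by (simp_all add: divide_simps abs_mult mult.commute)
    have "\<bar>?u\<bar> \<le> real m * \<bar>?u\<bar>" using m(1) mult_right_mono[of 1 "real m" "\<bar>?u\<bar>"] by simp
    with * have "g ?u \<in> carrier G" by (intro car) linarith
    moreover have "g (t / real n) = g ?u [^] m" using pow[OF *(1)] m(1) by simp
    moreover have "g (t / real m) = g ?u [^] n" using pow[OF *(2)] n(1) by simp
    ultimately show ?thesis by (simp add: nat_pow_pow mult.commute)
  qed
  \<comment> \<open>The summand 1 keeps the exponent positive at t = 0.\<close>
  define N where "N t = nat \<lceil>\<bar>t\<bar> / \<delta>\<rceil> + 1" for t
  have N: "N t > 0" "\<bar>t\<bar> \<le> real (N t) * \<delta>" for t
  proof -
    show "N t > 0" unfolding N_def by simp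
    have "\<bar>t\<bar> / \<delta> \<le> real (N t)" unfolding N_def by linarith
    then show "\<bar>t\<bar> \<le> real (N t) * \<delta>" using \<open>\<delta> > 0\<close> by (simp add: divide_simps)
  qed
  define \<gamma> where "\<gamma> t = g (t / real (N t)) [^] N t" for t
  have \<gamma>: "\<gamma> t = g (t / real n) [^] n" if "n > 0" "\<bar>t\<bar> \<le> real n * \<delta>" for t n
    unfolding \<gamma>_def by (rule indep[OF N that])
  have small: "\<bar>t / real n\<bar> \<le> \<delta>" if "n > 0" "\<bar>t\<bar> \<le> real n * \<delta>" for t n
    using that by (simp add: divide_simps mult.commute)
  show ?thesis
  proof (rule that[of \<gamma>])
    show "\<gamma> t \<in> carrier G" for t unfolding \<gamma>_def by (intro nat_pow_closed car small N)
    show "\<gamma> (s + t) = \<gamma> s \<otimes> \<gamma> t" for s t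
    proof -
      \<comment> \<open>An exponent admissible for s, t and s + t alike. The values of
        \<open>g\<close> at s / n and t / n commute because addition does, so the power of their
        product splits.\<close>
      define n where "n = N (\<bar>s\<bar> + \<bar>t\<bar>)"
      have n: "n > 0" "\<bar>s\<bar> \<le> real n * \<delta>" "\<bar>t\<bar> \<le> real n * \<delta>" "\<bar>s + t\<bar> \<le> real n * \<delta>"
        using N[of "\<bar>s\<bar> + \<bar>t\<bar>"] unfolding n_def by auto
      note sm = small[OF n(1,2)] small[OF n(1,3)]
      have "g (s / real n) \<otimes> g (t / real n) = g (t / real n) \<otimes> g (s / real n)"
        using hom[OF sm] hom[OF sm(2,1)] by (simp add: add.commute)
      then have "(g (s / real n) \<otimes> g (t / real n)) [^] n = g (s / real n) [^] n \<otimes> g (t / real n) [^] n"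
        by (intro pow_mult_distrib car sm)
      moreover have "g ((s + t) / real n) = g (s / real n) \<otimes> g (t / real n)"
        using hom[OF sm] by (simp add: add_divide_distrib)
      ultimately show ?thesis using \<gamma>[OF n(1,2)] \<gamma>[OF n(1,3)] \<gamma>[OF n(1,4)] by simp
    qed
    show "\<gamma> t = g t" if "\<bar>t\<bar> \<le> \<delta>" for t
      using \<gamma>[of 1 t] that car[OF that] by simp
    show "continuous_map euclideanreal (topol G) \<gamma>"
      unfolding continuous_map_def
    proof (intro conjI allI impI funcsetI)
      show "\<gamma> t \<in> topspace (topol G)" for t
        unfolding \<gamma>_def topspace by (intro nat_pow_closed car small N)
      fix S assume S: "openin (topol G) S"
      \<comment> \<open>On \<open>I n\<close> the exponent n can be held fixed, whereas
        \<open>N t\<close> jumps with t; continuity is checked on these open intervals.\<close>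
      define I where "I n = {-(real n * \<delta>)<..<real n * \<delta>}" for n
      have op: "open {t \<in> I n. \<gamma> t \<in> S}" if "n > 0" for n
      proof -
        have "continuous_map (top_of_set (I n)) (top_of_set {-\<delta>..\<delta>}) (\<lambda>t. t / real n)"
          using that by (auto simp: I_def divide_simps mult.commute intro!: continuous_intros)
        from continuous_map_compose[OF continuous_map_compose[OF this cont] continuous_map_nat_pow[of n]]
        have "continuous_map (top_of_set (I n)) (topol G) (\<lambda>t. g (t / real n) [^] n)" by (simp add: o_def)
        then have "continuous_map (top_of_set (I n)) (topol G) \<gamma>"
          by (rule continuous_map_eq) (use \<gamma>[OF that] in \<open>auto simp: I_def abs_le_iff\<close>)
        from openin_continuous_map_preimage[OF this S]
        have "openin (top_of_set (I n)) {t \<in> I n. \<gamma> t \<in> S}" by simp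
        moreover have "open (I n)" unfolding I_def by simp
        ultimately show ?thesis using openin_open_trans by blast
      qed
      \<comment> \<open>One more than \<open>N t\<close>, because \<open>I n\<close> is open while
        \<open>N\<close> guarantees only a weak inequality.\<close>
      have "t \<in> I (Suc (N t))" for t
        using N(2)[of t] \<open>\<delta> > 0\<close> unfolding I_def by (auto simp: algebra_simps)
      then have "{t. \<gamma> t \<in> S} = (\<Union>n\<in>{0<..}. {t \<in> I n. \<gamma> t \<in> S})" by blast
      moreover have "open (\<Union>n\<in>{0<..}. {t \<in> I n. \<gamma> t \<in> S})" using op by (intro open_UN) auto
      ultimately show "openin euclideanreal {t \<in> topspace euclideanreal. \<gamma> t \<in> S}" by simp
    qed
  qed
qed

lemma one_parameter_subgroup_exists: obtains \<gamma> where "one_parameter_subgroup G c \<xi> \<gamma>"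
proof -
  obtain x \<delta> where x: "\<delta> > 0" "x 0 = e0" "(x has_vector_derivative \<xi>) (at 0)"
    "\<And>t. \<bar>t\<bar> \<le> \<delta> \<Longrightarrow> x t \<in> \<Omega>" "continuous_on {-\<delta>..\<delta>} x"
    "\<And>s t. \<bar>s\<bar> \<le> \<delta> \<Longrightarrow> \<bar>t\<bar> \<le> \<delta> \<Longrightarrow> \<psi> (x (s + t)) = \<psi> (x s) \<otimes> \<psi> (x t)"
    using local_one_parameter_subgroup[of \<xi>] by metis
  have "continuous_map (top_of_set {-\<delta>..\<delta>}) (top_of_set (snd c ` fst c)) x"
    using x(4,5) by (auto simp: \<Omega>_def[symmetric] abs_le_iff)
  from continuous_map_compose[OF this continuous_map_chart_inv[OF mfd c_atlas]]
  have cont: "continuous_map (top_of_set {-\<delta>..\<delta>}) (topol G) (\<lambda>t. \<psi> (x t))" by (simp add: o_def)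
  obtain \<gamma> where \<gamma>: "\<And>t. \<gamma> t \<in> carrier G" "\<And>s t. \<gamma> (s + t) = \<gamma> s \<otimes> \<gamma> t"
    "continuous_map euclideanreal (topol G) \<gamma>" "\<And>t. \<bar>t\<bar> \<le> \<delta> \<Longrightarrow> \<gamma> t = \<psi> (x t)"
    by (rule extend_local_homomorphism[OF x(1) _ _ x(6) cont]) (auto simp: x \<psi>_carrier \<psi>_e0)
  have "((\<lambda>t. snd c (\<gamma> t)) has_vector_derivative \<xi>) (at 0)"
  proof (rule has_vector_derivative_transform_within_open[OF x(3)])
    show "open {-\<delta><..<\<delta>}" "0 \<in> {-\<delta><..<\<delta>}" using x(1) by auto
    show "x t = snd c (\<gamma> t)" if "t \<in> {-\<delta><..<\<delta>}" for t
      using that \<gamma>(4)[of t] x(4)[of t] by (simp add: c_\<psi> abs_le_iff)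
  qed
  then show ?thesis using that[of \<gamma>] \<gamma> unfolding one_parameter_subgroup_def by blast
qed

end

section \<open>The exponential map and the bracket of the group\<close>

lemma one_parameter_subgroup_rescale:
  assumes "one_parameter_subgroup G c \<xi> \<gamma>"
  shows "one_parameter_subgroup G c (a *\<^sub>R \<xi>) (\<lambda>s. \<gamma> (a * s))"
proof -
  have "continuous_map euclideanreal euclideanreal (\<lambda>s. a * s)" by (auto intro!: continuous_intros)
  from continuous_map_compose[OF this] assms
  have "continuous_map euclideanreal (topol G) (\<lambda>s. \<gamma> (a * s))"
    unfolding one_parameter_subgroup_def by (auto simp: o_def)
  moreover have "(((\<lambda>t. snd c (\<gamma> t)) \<circ> (\<lambda>s. a * s)) has_vector_derivative (a *\<^sub>R \<xi>)) (at 0)"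
    using assms unfolding one_parameter_subgroup_def
    by (intro vector_diff_chain_at) (auto intro!: derivative_eq_intros)
  ultimately show ?thesis
    using assms unfolding one_parameter_subgroup_def by (auto simp: o_def distrib_left)
qed

text \<open>Uniqueness makes the definite description determinate; it is an assumption here so that
  the lemma serves both G and the semidirect product. By rescaling, time 1 in direction
  \<open>t *\<^sub>R \<xi>\<close> is time t in direction \<xi>.\<close>

lemma lie_exp_eq:
  assumes \<gamma>: "one_parameter_subgroup G c \<xi> \<gamma>"
    and unique: "\<And>\<eta> \<gamma> \<gamma>'. one_parameter_subgroup G c \<eta> \<gamma> \<Longrightarrow> one_parameter_subgroup G c \<eta> \<gamma>' \<Longrightarrow> \<gamma> = \<gamma>'"
  shows "lie_exp G c (t *\<^sub>R \<xi>) = \<gamma> t"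
proof -
  have "(THE \<gamma>. one_parameter_subgroup G c (t *\<^sub>R \<xi>) \<gamma>) = (\<lambda>s. \<gamma> (t * s))"
    using one_parameter_subgroup_rescale[OF \<gamma>] unique by (intro the_equality) blast+
  then show ?thesis unfolding lie_exp_def by simp
qed

context lie_group_chart
begin

lemma Ad_one_parameter_subgroup:
  assumes \<gamma>: "one_parameter_subgroup G c \<xi> \<gamma>"
  shows "((\<lambda>t. Ad G c (\<gamma> t) \<eta>) has_vector_derivative \<beta> \<xi> \<eta>) (at 0)"
proof -
  let ?y = "\<lambda>t. snd c (\<gamma> t)"
  have "?y 0 = e0" using one_parameter_subgroup_one[OF \<gamma>] by (simp add: e0_def)
  then have "((\<lambda>t. Ad G c (\<psi> (?y t)) \<eta>) has_derivative (\<lambda>h. \<beta> (h *\<^sub>R \<xi>) \<eta>)) (at 0)"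
    using Ad_chart_has_derivative[of \<eta>]
    by (intro has_derivative_compose[OF one_parameter_subgroup_near_zero(2)[OF \<gamma>]]) simp
  moreover have "\<forall>\<^sub>F t in nhds 0. Ad G c (\<psi> (?y t)) \<eta> = Ad G c (\<gamma> t) \<eta>"
    using one_parameter_subgroup_near_zero(1)[OF \<gamma>] by eventually_elim (simp add: \<psi>_c)
  ultimately have "((\<lambda>t. Ad G c (\<gamma> t) \<eta>) has_derivative (\<lambda>h. \<beta> (h *\<^sub>R \<xi>) \<eta>)) (at 0)"
    using has_derivative_transform_eventually[of "\<lambda>t. Ad G c (\<psi> (?y t)) \<eta>" _ 0 UNIV "\<lambda>t. Ad G c (\<gamma> t) \<eta>"]
    by (auto simp: eventually_nhds_conv_at)
  then show ?thesis unfolding has_vector_derivative_def by (simp add: linear_scale[OF linear_\<beta>1])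
qed

lemma lie_bracket_eq: "lie_bracket G c \<xi> \<eta> = \<beta> \<xi> \<eta>"
proof -
  obtain \<gamma> where \<gamma>: "one_parameter_subgroup G c \<xi> \<gamma>" by (rule one_parameter_subgroup_exists)
  have "lie_exp G c (t *\<^sub>R \<xi>) = \<gamma> t" for t
    by (rule lie_exp_eq[OF \<gamma> one_parameter_subgroup_unique])
  then show ?thesis
    unfolding lie_bracket_def using vector_derivative_at[OF Ad_one_parameter_subgroup[OF \<gamma>]] by simp
qed

text \<open>Conjugation by \<open>\<gamma> t\<close> fixes the commuting elements \<open>\<gamma> s\<close>, hence \<open>Ad (\<gamma> t)\<close> fixes \<open>\<xi>\<close>.\<close>

lemma \<beta>_self: "\<beta> \<xi> \<xi> = 0"
proof -
  obtain \<gamma> where \<gamma>: "one_parameter_subgroup G c \<xi> \<gamma>" by (rule one_parameter_subgroup_exists)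
  have car: "\<gamma> t \<in> carrier G" and hom: "\<gamma> (s + t) = \<gamma> s \<otimes> \<gamma> t" for s t
    using \<gamma> unfolding one_parameter_subgroup_def by auto
  let ?y = "\<lambda>t. snd c (\<gamma> t)"
  have y0: "?y 0 = e0" using one_parameter_subgroup_one[OF \<gamma>] by (simp add: e0_def)
  have "Ad G c (\<gamma> t) \<xi> = \<xi>" for t
  proof -
    have "((\<lambda>s. conj_in (\<gamma> t) (?y s)) has_derivative (\<lambda>h. Ad G c (\<gamma> t) (h *\<^sub>R \<xi>))) (at 0)"
      using Ad_has_derivative[OF car[of t]] y0
      by (intro has_derivative_compose[OF one_parameter_subgroup_near_zero(2)[OF \<gamma>]]) simp
    moreover have "\<forall>\<^sub>F s in nhds 0. conj_in (\<gamma> t) (?y s) = ?y s"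
      using one_parameter_subgroup_near_zero(1)[OF \<gamma>]
    proof eventually_elim
      case (elim s)
      have "\<gamma> s \<otimes> \<gamma> t = \<gamma> t \<otimes> \<gamma> s" using hom by (metis add.commute)
      then have "inv (\<gamma> t) \<otimes> \<gamma> s \<otimes> \<gamma> t = \<gamma> s" using car by (simp add: m_assoc inv_solve_left')
      then show ?case using elim by (simp add: conj_in_def \<psi>_c)
    qed
    ultimately have "(\<lambda>h. Ad G c (\<gamma> t) (h *\<^sub>R \<xi>)) = (\<lambda>h. h *\<^sub>R \<xi>)"
      using has_derivative_eventually_unique one_parameter_subgroup_near_zero(2)[OF \<gamma>] by blast
    from fun_cong[OF this, of 1] show ?thesis by simp
  qed
  then have "((\<lambda>t. \<xi>) has_vector_derivative \<beta> \<xi> \<xi>) (at (0::real))"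
    using Ad_one_parameter_subgroup[OF \<gamma>, of \<xi>] by simp
  then show ?thesis using vector_derivative_at has_vector_derivative_const by metis
qed

text \<open>Polarisation: \<open>\<beta>_self\<close> is expanded at the sum of the two
  vectors.\<close>

lemma \<beta>_antisym: "\<beta> \<xi> \<eta> = - \<beta> \<eta> \<xi>"
proof -
  have "\<beta> (\<xi> + \<eta>) (\<xi> + \<eta>) = \<beta> \<xi> \<xi> + \<beta> \<eta> \<xi> + (\<beta> \<xi> \<eta> + \<beta> \<eta> \<eta>)"
    by (simp add: linear_add[OF linear_\<beta>1] linear_add[OF linear_\<beta>2])
  then show ?thesis by (simp add: \<beta>_self eq_neg_iff_add_eq_0 add.commute)
qed

end

section \<open>The semidirect product\<close>

text \<open>The product rule at a zero of w: the variation of \<open>A\<close> is multiplied by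
  \<open>w x0 = 0\<close>, so its convergence to the identity suffices and only the derivative of w
  survives. In use, \<open>A\<close> is \<open>Ad\<close> along a one-parameter subgroup.\<close>

lemma has_derivative_near_identity_apply:
  fixes A :: "'a::real_normed_vector \<Rightarrow> 'e::real_normed_vector \<Rightarrow> 'e"
  assumes B: "finite (B :: 'e set)" "span B = UNIV"
    and lin: "\<And>x. linear (A x)"
    and lim: "\<And>v. ((\<lambda>x. A x v) \<longlongrightarrow> v) (nhds x0)"
    and der: "(w has_derivative w') (at x0)" and w0: "w x0 = 0"
  shows "((\<lambda>x. A x (w x)) has_derivative w') (at x0)"
proof -
  obtain K where K: "K > 0" "\<forall>\<^sub>F x in nhds x0. norm (w x - w x0) \<le> K * norm (x - x0)"
    by (rule has_derivative_eventually_bound[OF der])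
  have "((\<lambda>x. A x (w x) - w x) has_derivative (\<lambda>_. 0)) (at x0)"
  proof (rule has_derivative_zeroI)
    show "A x0 (w x0) - w x0 = 0" using w0 linear_0[OF lin] by simp
    fix \<epsilon> :: real assume "\<epsilon> > 0"
    have "\<forall>\<^sub>F x in nhds x0. \<forall>v. norm (A x v - v) \<le> (\<epsilon> / K) * norm v"
    proof (rule eventually_uniformly_small_finite_span[OF B])
      show "\<forall>\<^sub>F x in nhds x0. linear (\<lambda>v. A x v - v)"
        by (intro always_eventually allI linear_compose_sub lin linear_id[unfolded id_def])
      show "((\<lambda>x. A x v - v) \<longlongrightarrow> 0) (nhds x0)" for v using lim[of v] by (simp add: LIM_zero)
    qed (use \<open>\<epsilon> > 0\<close> K(1) in simp)
    with K(2) show "\<forall>\<^sub>F x in nhds x0. norm (A x (w x) - w x) \<le> \<epsilon> * norm (x - x0)"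
    proof eventually_elim
      case (elim x)
      have "norm (A x (w x) - w x) \<le> (\<epsilon> / K) * norm (w x)" using elim by blast
      also have "\<dots> \<le> (\<epsilon> / K) * (K * norm (x - x0))"
        using elim(1) w0 \<open>\<epsilon> > 0\<close> K(1) by (intro mult_left_mono) auto
      finally show ?case using K(1) by simp
    qed
  qed
  from has_derivative_add[OF this der] show ?thesis by simp
qed

lemma vector_derivative_zero_constant:
  fixes f :: "real \<Rightarrow> 'e::real_normed_vector"
  assumes "\<And>t. (f has_vector_derivative 0) (at t)"
  shows "f s = f t"
  using has_derivative_zero_unique[of UNIV f s t] assms by (simp add: has_vector_derivative_def)

context lie_group_chart
begin

abbreviation "SD \<equiv> semidirect G c"
abbreviation "sc \<equiv> semidirect_chart c"

lemmas linear_Ad = bounded_linear.linear[OF bounded_linear_Ad]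

lemma SD_simps:
  "carrier SD = carrier G \<times> UNIV" "one SD = (\<one>, 0)"
  "mult SD (g, \<xi>) (h, \<eta>) = (g \<otimes> h, \<xi> + Ad G c (inv g) \<eta>)"
  "topol SD = prod_topology (topol G) euclidean"
  by (simp_all add: semidirect_def)

text \<open>Associativity holds because \<open>Ad\<close> and inversion both reverse products, so
  that \<open>Ad (inv g)\<close> is a linear action of G.\<close>

lemma group_SD: "group SD"
proof (rule groupI)
  fix p q r assume "p \<in> carrier SD" "q \<in> carrier SD" "r \<in> carrier SD"
  then show "p \<otimes>\<^bsub>SD\<^esub> q \<otimes>\<^bsub>SD\<^esub> r = p \<otimes>\<^bsub>SD\<^esub> (q \<otimes>\<^bsub>SD\<^esub> r)"
    by (cases p; cases q; cases r)
      (simp add: SD_simps m_assoc inv_mult_group Ad_mult linear_add[OF linear_Ad] add.assoc)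
next
  fix p assume "p \<in> carrier SD"
  then obtain g \<xi> where p: "p = (g, \<xi>)" "g \<in> carrier G" by (auto simp: SD_simps)
  then show "\<exists>y\<in>carrier SD. y \<otimes>\<^bsub>SD\<^esub> p = \<one>\<^bsub>SD\<^esub>"
    by (intro bexI[of _ "(inv g, - Ad G c g \<xi>)"]) (auto simp: SD_simps)
qed (auto simp: SD_simps Ad_one)

lemma inv_SD: "g \<in> carrier G \<Longrightarrow> m_inv SD (g, \<xi>) = (inv g, - Ad G c g \<xi>)"
  by (rule group.inv_equality[OF group_SD]) (auto simp: SD_simps)

lemma sc_simps:
  "snd sc (g, \<xi>) = (snd c g, \<xi>)" "x \<in> \<Omega> \<Longrightarrow> chart_inv sc (x, y) = (\<psi> x, y)"
proof -
  show "snd sc (g, \<xi>) = (snd c g, \<xi>)" by (simp add: semidirect_chart_def prod_chart_def)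
  have "chart_inv (UNIV, id) y = y" by (simp add: chart_inv_def inv_into_f_eq)
  then show "x \<in> \<Omega> \<Longrightarrow> chart_inv sc (x, y) = (\<psi> x, y)"
    unfolding semidirect_chart_def \<Omega>_def
    by (subst chart_inv_prod_chart) (auto simp: chart_inj[OF mfd c_atlas])
qed

text \<open>Multiplied out, the conjugate of \<open>(h, y)\<close> by \<open>(g, \<xi>)\<close> has
  second component \<open>- Ad g \<xi> + Ad g y + Ad g (Ad (inv h) \<xi>)\<close>. It is affine in
  y, and \<open>Ad_chart_inv_has_derivative\<close> differentiates the last term in h, which
  contributes \<beta>.\<close>

lemma Ad_SD:
  assumes g: "g \<in> carrier G"
  shows "Ad SD sc (g, \<xi>) (\<eta>, \<zeta>) = (Ad G c g \<eta>, Ad G c g (\<zeta> - \<beta> \<eta> \<xi>))"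
proof -
  let ?F = "\<lambda>p. (conj_in g (fst p), - Ad G c g \<xi> + Ad G c g (snd p) + Ad G c g (Ad G c (inv (\<psi> (fst p))) \<xi>))"
  let ?C = "\<lambda>p. snd sc (m_inv SD (g, \<xi>) \<otimes>\<^bsub>SD\<^esub> chart_inv sc p \<otimes>\<^bsub>SD\<^esub> (g, \<xi>))"
  let ?D = "\<lambda>h. (Ad G c g (fst h), Ad G c g (snd h) + Ad G c g (- \<beta> (fst h) \<xi>))"
  have fst': "(fst has_derivative fst) (at (e0, 0))" "(snd has_derivative snd) (at (e0, 0::'e))"
    by (auto intro!: bounded_linear_imp_has_derivative bounded_linear_fst bounded_linear_snd)
  have "((\<lambda>p. conj_in g (fst p)) has_derivative (\<lambda>h. Ad G c g (fst h))) (at (e0, 0::'e))"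
    using Ad_has_derivative[OF g] by (intro has_derivative_compose[OF fst'(1)]) simp
  moreover have "((\<lambda>p. Ad G c g (snd p)) has_derivative (\<lambda>h. Ad G c g (snd h))) (at (e0, 0))"
    by (rule bounded_linear.has_derivative[OF bounded_linear_Ad[OF g] fst'(2)])
  moreover have "((\<lambda>p. Ad G c g (Ad G c (inv (\<psi> (fst p))) \<xi>)) has_derivative (\<lambda>h. Ad G c g (- \<beta> (fst h) \<xi>)))
      (at (e0, 0::'e))"
    using Ad_chart_inv_has_derivative[of \<xi>]
    by (intro bounded_linear.has_derivative[OF bounded_linear_Ad[OF g]] has_derivative_compose[OF fst'(1)]) simp
  ultimately have "(?F has_derivative ?D) (at (e0, 0))"
    by (auto intro!: derivative_eq_intros)
  moreover have "?F p = ?C p" if p: "p \<in> \<Omega> \<times> UNIV" for p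
  proof -
    obtain x y where xy: "p = (x, y)" "x \<in> \<Omega>" using p by auto
    then show ?thesis
      using g by (simp add: inv_SD sc_simps SD_simps conj_in_def inv_mult_group \<psi>_carrier Ad_mult)
  qed
  moreover have "open (\<Omega> \<times> (UNIV :: 'e set))" using open_\<Omega> by (intro open_Times) auto
  ultimately have C: "(?C has_derivative ?D) (at (e0, 0))"
    using has_derivative_transform_within_open[of ?F ?D "(e0, 0)" UNIV "\<Omega> \<times> UNIV" ?C] e0_in by auto
  have one: "snd sc \<one>\<^bsub>SD\<^esub> = (e0, 0)" by (simp add: SD_simps sc_simps e0_def)
  have "Ad SD sc (g, \<xi>) = ?D"
    unfolding Ad_def[of SD] one by (rule frechet_derivative_at[OF C, symmetric])
  then show ?thesis using linear_add[OF linear_Ad[OF g], of \<zeta> "- \<beta> \<eta> \<xi>"] by simp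
qed

text \<open>The second component is a crossed homomorphism: its additivity is twisted by the action
  \<open>Ad (inv (\<gamma> s))\<close>. Separating it reduces these curves to one-parameter
  subgroups of G and a vector-valued function v.\<close>

lemma one_parameter_subgroup_SD_iff:
  "one_parameter_subgroup SD sc (\<xi>, \<eta>) (\<lambda>t. (\<gamma> t, v t)) \<longleftrightarrow>
     one_parameter_subgroup G c \<xi> \<gamma> \<and> (\<forall>s t. v (s + t) = v s + Ad G c (inv (\<gamma> s)) (v t)) \<and>
     continuous_on UNIV v \<and> (v has_vector_derivative \<eta>) (at 0)"
proof -
  have "((\<lambda>t. (snd c (\<gamma> t), v t)) has_vector_derivative (\<xi>, \<eta>)) (at 0) \<longleftrightarrow>
      ((\<lambda>t. snd c (\<gamma> t)) has_vector_derivative \<xi>) (at 0) \<and> (v has_vector_derivative \<eta>) (at 0)"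
    (is "?L \<longleftrightarrow> ?R")
  proof
    assume ?L
    from bounded_linear.has_vector_derivative[OF bounded_linear_fst this]
      bounded_linear.has_vector_derivative[OF bounded_linear_snd this]
    show ?R by simp
  next
    assume ?R then show ?L by (auto intro: has_vector_derivative_Pair)
  qed
  then show ?thesis
    unfolding one_parameter_subgroup_def
    by (auto simp: SD_simps sc_simps continuous_map_pairwise o_def)
qed

lemma one_parameter_subgroup_inv:
  assumes \<gamma>: "one_parameter_subgroup G c \<xi> \<gamma>" shows "inv (\<gamma> t) = \<gamma> (- t)"
proof (rule inv_equality)
  show "\<gamma> (- t) \<otimes> \<gamma> t = \<one>"
    using \<gamma> one_parameter_subgroup_one[OF \<gamma>] unfolding one_parameter_subgroup_def
    by (metis add.left_inverse)
qed (use \<gamma> in \<open>auto simp: one_parameter_subgroup_def\<close>)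

lemma Ad_one_parameter_subgroup_tendsto:
  assumes \<gamma>: "one_parameter_subgroup G c \<xi> \<gamma>"
  shows "((\<lambda>t. Ad G c (\<gamma> t) v) \<longlongrightarrow> v) (nhds 0)"
proof -
  have "isCont (\<lambda>t. Ad G c (\<gamma> t) v) 0"
    by (rule has_vector_derivative_continuous[OF Ad_one_parameter_subgroup[OF \<gamma>]])
  then show ?thesis
    using tendsto_at_iff_tendsto_nhds[of "\<lambda>t. Ad G c (\<gamma> t) v" 0]
    by (simp add: isCont_def one_parameter_subgroup_one[OF \<gamma>] Ad_one)
qed

text \<open>\<gamma> t may leave the chart, so continuity is known directly only at 0; the
  homomorphism law moves it to any t.\<close>

lemma continuous_Ad_one_parameter_subgroup:
  assumes \<gamma>: "one_parameter_subgroup G c \<xi> \<gamma>"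
  shows "continuous_on UNIV (\<lambda>t. Ad G c (\<gamma> t) v)"
proof -
  have car: "\<gamma> t \<in> carrier G" and hom: "\<gamma> (s + t) = \<gamma> s \<otimes> \<gamma> t" for s t
    using \<gamma> unfolding one_parameter_subgroup_def by auto
  have "isCont (\<lambda>t. Ad G c (\<gamma> t) v) t" for t
  proof -
    have "Ad G c (\<gamma> (t + h)) v = Ad G c (\<gamma> h) (Ad G c (\<gamma> t) v)" for h
      by (simp add: hom Ad_mult car)
    moreover have "((\<lambda>h. Ad G c (\<gamma> h) (Ad G c (\<gamma> t) v)) \<longlongrightarrow> Ad G c (\<gamma> t) v) (at 0)"
      by (rule tendsto_mono[OF _ Ad_one_parameter_subgroup_tendsto[OF \<gamma>]]) (simp add: at_within_def)
    ultimately show ?thesis by (simp add: isCont_iff)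
  qed
  then show ?thesis by (simp add: continuous_on_eq_continuous_at)
qed

text \<open>Obtained by differentiating the twisted additivity in t at 0. The derivative of v
  involves only \<gamma> and \<eta>, which yields uniqueness and dictates the construction of
  v.\<close>

lemma one_parameter_subgroup_SD_derivative:
  assumes "one_parameter_subgroup SD sc (\<xi>, \<eta>) (\<lambda>t. (\<gamma> t, v t))"
  shows "(v has_vector_derivative Ad G c (inv (\<gamma> s)) \<eta>) (at s)" and "v 0 = 0"
proof -
  have \<gamma>: "one_parameter_subgroup G c \<xi> \<gamma>" and v: "\<And>s t. v (s + t) = v s + Ad G c (inv (\<gamma> s)) (v t)"
    and v': "(v has_vector_derivative \<eta>) (at 0)"
    using assms unfolding one_parameter_subgroup_SD_iff by auto
  have car: "inv (\<gamma> s) \<in> carrier G" for s using \<gamma> unfolding one_parameter_subgroup_def by auto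
  show "v 0 = 0" using v[of 0 0] by (simp add: one_parameter_subgroup_one[OF \<gamma>] Ad_one)
  have "((\<lambda>t. v s + Ad G c (inv (\<gamma> s)) (v t)) has_vector_derivative Ad G c (inv (\<gamma> s)) \<eta>) (at 0)"
    using bounded_linear.has_vector_derivative[OF bounded_linear_Ad[OF car[of s]] v']
    by (auto intro!: derivative_eq_intros)
  then have "((\<lambda>t. v (s + t)) has_vector_derivative Ad G c (inv (\<gamma> s)) \<eta>) (at 0)" by (simp add: v)
  then have "(((\<lambda>t. v (s + t)) \<circ> (\<lambda>t. t - s)) has_vector_derivative (1 *\<^sub>R Ad G c (inv (\<gamma> s)) \<eta>)) (at s)"
    by (intro vector_diff_chain_at) (auto intro!: derivative_eq_intros)
  then show "(v has_vector_derivative Ad G c (inv (\<gamma> s)) \<eta>) (at s)" by (simp add: o_def)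
qed

lemma one_parameter_subgroup_SD_unique:
  assumes "one_parameter_subgroup SD sc \<alpha> \<Gamma>" "one_parameter_subgroup SD sc \<alpha> \<Gamma>'"
  shows "\<Gamma> = \<Gamma>'"
proof -
  obtain \<xi> \<eta> where \<alpha>: "\<alpha> = (\<xi>, \<eta>)" by force
  define \<gamma> v \<gamma>' v' where "\<gamma> = fst \<circ> \<Gamma>" "v = snd \<circ> \<Gamma>" "\<gamma>' = fst \<circ> \<Gamma>'" "v' = snd \<circ> \<Gamma>'"
  then have \<Gamma>: "\<Gamma> = (\<lambda>t. (\<gamma> t, v t))" "\<Gamma>' = (\<lambda>t. (\<gamma>' t, v' t))" by auto
  note ops = assms[unfolded \<Gamma> \<alpha>]
  have eq: "\<gamma> = \<gamma>'"
    using ops one_parameter_subgroup_unique unfolding one_parameter_subgroup_SD_iff by blast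
  have "((\<lambda>t. v t - v' t) has_vector_derivative 0) (at t)" for t
    using has_vector_derivative_diff[OF one_parameter_subgroup_SD_derivative(1)[OF ops(1), of t]
        one_parameter_subgroup_SD_derivative(1)[OF ops(2), of t]] eq by simp
  from vector_derivative_zero_constant[OF this]
  have "v t - v' t = v 0 - v' 0" for t .
  then have "v = v'"
    using one_parameter_subgroup_SD_derivative(2)[OF ops(1)] one_parameter_subgroup_SD_derivative(2)[OF ops(2)] by auto
  with eq show ?thesis unfolding \<Gamma> by simp
qed

text \<open>v is the antiderivative of \<open>Ad (inv (\<gamma> t)) \<eta>\<close> vanishing at 0.
  For fixed s the two sides of the twisted additivity have the same derivative in t and agree at t =
  0.\<close>

lemma one_parameter_subgroup_SD_exists:
  obtains \<gamma> v where "one_parameter_subgroup SD sc (\<xi>, \<eta>) (\<lambda>t. (\<gamma> t, v t))"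
proof -
  obtain \<gamma> where \<gamma>: "one_parameter_subgroup G c \<xi> \<gamma>" by (rule one_parameter_subgroup_exists)
  have car: "\<gamma> t \<in> carrier G" and hom: "\<gamma> (s + t) = \<gamma> s \<otimes> \<gamma> t" for s t
    using \<gamma> unfolding one_parameter_subgroup_def by auto
  define a where "a t = Ad G c (inv (\<gamma> t)) \<eta>" for t
  have "continuous_on UNIV (\<lambda>t. Ad G c (\<gamma> (- t)) \<eta>)"
    by (rule continuous_on_compose2[OF continuous_Ad_one_parameter_subgroup[OF \<gamma>]])
      (auto intro!: continuous_intros)
  then have "continuous_on UNIV a" unfolding a_def by (simp add: one_parameter_subgroup_inv[OF \<gamma>])
  then obtain v where v: "v 0 = 0" "\<And>t. (v has_vector_derivative a t) (at t)"
    using antiderivative_exists by metis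
  have a: "a (s + t) = Ad G c (inv (\<gamma> s)) (a t)" for s t
    unfolding a_def by (simp add: hom inv_mult_group car Ad_mult)
  have "v (s + t) = v s + Ad G c (inv (\<gamma> s)) (v t)" for s t
  proof -
    have "((\<lambda>t. v (s + t) - Ad G c (inv (\<gamma> s)) (v t)) has_vector_derivative 0) (at t)" for t
    proof -
      have "((v \<circ> (\<lambda>t. s + t)) has_vector_derivative 1 *\<^sub>R a (s + t)) (at t)"
        by (rule vector_diff_chain_at) (auto intro!: derivative_eq_intros v)
      moreover have "((\<lambda>t. Ad G c (inv (\<gamma> s)) (v t)) has_vector_derivative Ad G c (inv (\<gamma> s)) (a t)) (at t)"
        using car by (intro bounded_linear.has_vector_derivative[OF bounded_linear_Ad] v) auto
      ultimately show ?thesis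
        using has_vector_derivative_diff[of "\<lambda>t. v (s + t)"] by (fastforce simp: o_def a)
    qed
    from vector_derivative_zero_constant[OF this, of t 0] show ?thesis
      using v(1) linear_0[OF linear_Ad[of "inv (\<gamma> s)"]] car by (simp add: algebra_simps)
  qed
  moreover have "continuous_on UNIV v"
    using v(2) by (intro continuous_on_vector_derivative) simp
  moreover have "(v has_vector_derivative \<eta>) (at 0)"
    using v(2)[of 0] by (simp add: a_def one_parameter_subgroup_one[OF \<gamma>] Ad_one)
  ultimately show ?thesis
    using that[of \<gamma> v] \<gamma> unfolding one_parameter_subgroup_SD_iff by blast
qed

text \<open>By \<open>Ad_SD\<close> the second component along the curve is
  \<open>Ad (\<gamma> t)\<close> applied to \<open>\<eta>' - \<beta> \<eta> (v t)\<close>. The first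
  term contributes \<open>\<beta> \<xi> \<eta>'\<close>; in the second the argument vanishes at t =
  0, so only the derivative \<xi>' of v enters.\<close>

lemma lie_bracket_SD:
  "lie_bracket SD sc (\<xi>, \<xi>') (\<eta>, \<eta>') =
     (lie_bracket G c \<xi> \<eta>, lie_bracket G c \<xi> \<eta>' - lie_bracket G c \<eta> \<xi>')"
proof -
  obtain B :: "'e set" where B: "finite B" "span B = UNIV" by (rule finite_span)
  obtain \<gamma> v where ops: "one_parameter_subgroup SD sc (\<xi>, \<xi>') (\<lambda>t. (\<gamma> t, v t))"
    by (rule one_parameter_subgroup_SD_exists)
  then have \<gamma>: "one_parameter_subgroup G c \<xi> \<gamma>" and v': "(v has_vector_derivative \<xi>') (at 0)"
    unfolding one_parameter_subgroup_SD_iff by auto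
  have v0: "v 0 = 0" by (rule one_parameter_subgroup_SD_derivative(2)[OF ops])
  have car: "\<gamma> t \<in> carrier G" for t using \<gamma> unfolding one_parameter_subgroup_def by auto
  have exp: "lie_exp SD sc (t *\<^sub>R (\<xi>, \<xi>')) = (\<gamma> t, v t)" for t
    by (rule lie_exp_eq[OF ops one_parameter_subgroup_SD_unique])
  have bl: "bounded_linear (\<beta> \<eta>)"
    by (rule linear_imp_bounded_linear_finite_span[OF B linear_\<beta>2])
  have "((\<lambda>t. \<beta> \<eta> (v t)) has_vector_derivative \<beta> \<eta> \<xi>') (at 0)"
    by (rule bounded_linear.has_vector_derivative[OF bl v'])
  then have "((\<lambda>t. Ad G c (\<gamma> t) (\<beta> \<eta> (v t))) has_vector_derivative \<beta> \<eta> \<xi>') (at 0)"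
    unfolding has_vector_derivative_def
    by (rule has_derivative_near_identity_apply[OF B linear_Ad[OF car] Ad_one_parameter_subgroup_tendsto[OF \<gamma>]])
      (simp add: v0 linear_0[OF linear_\<beta>2])
  from has_vector_derivative_diff[OF Ad_one_parameter_subgroup[OF \<gamma>, of \<eta>'] this]
  have "((\<lambda>t. Ad G c (\<gamma> t) (\<eta>' - \<beta> \<eta> (v t))) has_vector_derivative \<beta> \<xi> \<eta>' - \<beta> \<eta> \<xi>') (at 0)"
    by (simp add: linear_diff[OF linear_Ad[OF car]])
  from has_vector_derivative_Pair[OF Ad_one_parameter_subgroup[OF \<gamma>, of \<eta>] this]
  have "((\<lambda>t. Ad SD sc (lie_exp SD sc (t *\<^sub>R (\<xi>, \<xi>'))) (\<eta>, \<eta>')) has_vector_derivative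
      (\<beta> \<xi> \<eta>, \<beta> \<xi> \<eta>' - \<beta> \<eta> \<xi>')) (at 0)"
    unfolding exp by (simp add: Ad_SD[OF car])
  then show ?thesis
    unfolding lie_bracket_def[of SD] lie_bracket_eq by (rule vector_derivative_at)
qed

end

section \<open>Lie--Poisson structures\<close>

lemma functional_derivative:
  fixes B :: "'k::real_normed_vector set" and F :: "('k \<Rightarrow>\<^sub>L real) \<Rightarrow> real"
  assumes B: "finite B" "span B = UNIV" and F: "F differentiable (at \<alpha>)"
  shows "frechet_derivative F (at \<alpha>) \<beta> = blinfun_apply \<beta> (functional_derivative F \<alpha>)"
proof -
  have "linear (frechet_derivative F (at \<alpha>))"
    using F frechet_derivative_works has_derivative_linear by blast
  from theI'[OF bidual_finite_span[OF B this]] show ?thesis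
    unfolding functional_derivative_def by blast
qed

lemma functional_derivative_eqI:
  fixes B :: "'k::real_normed_vector set" and F :: "('k \<Rightarrow>\<^sub>L real) \<Rightarrow> real"
  assumes B: "finite B" "span B = UNIV" and F: "(F has_derivative D) (at \<alpha>)"
    and D: "\<And>\<beta>. D \<beta> = blinfun_apply \<beta> \<xi>"
  shows "functional_derivative F \<alpha> = \<xi>"
proof -
  have "frechet_derivative F (at \<alpha>) = D" using frechet_derivative_at[OF F] by simp
  then show ?thesis
    unfolding functional_derivative_def
    using D bidual_finite_span[OF B has_derivative_linear[OF F]] by (intro the1_equality) auto
qed

section \<open>Functional derivatives on the dual of a product\<close>

lemma bounded_linear_dual_split:
  "bounded_linear (dual_split :: ('a::real_normed_vector \<times> 'b::real_normed_vector) \<Rightarrow>\<^sub>L real \<Rightarrow> _)"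
proof -
  have bl: "bounded_linear (\<lambda>x. (x, 0))" "bounded_linear (\<lambda>y. (0, y))"
    by (auto intro!: bounded_linear_Pair bounded_linear_ident bounded_linear_zero)
  \<comment> \<open>As composition with the two inclusions, the splitting is visibly bounded linear
    in \<alpha>.\<close>
  have eq: "dual_split \<alpha> = (\<alpha> o\<^sub>L Blinfun (\<lambda>x. (x, 0)), \<alpha> o\<^sub>L Blinfun (\<lambda>y. (0, y)))" for \<alpha> :: "('a \<times> 'b) \<Rightarrow>\<^sub>L real"
    by (auto intro!: prod_eqI blinfun_eqI simp: blinfun_apply_dual_split bounded_linear_Blinfun_apply bl)
  have "bounded_linear (\<lambda>\<alpha> :: ('a \<times> 'b) \<Rightarrow>\<^sub>L real.
      (\<alpha> o\<^sub>L Blinfun (\<lambda>x. (x, 0)), \<alpha> o\<^sub>L Blinfun (\<lambda>y. (0, y))))"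
    by (intro bounded_linear_Pair bounded_bilinear.bounded_linear_left[OF bounded_bilinear_blinfun_compose])
  then show ?thesis unfolding eq[symmetric] .
qed

lemma bounded_linear_dual_pair: "bounded_linear dual_pair"
  unfolding dual_pair_def[abs_def]
  by (intro bounded_linear_add bounded_linear_compose[OF
      bounded_bilinear.bounded_linear_left[OF bounded_bilinear_blinfun_compose]]
      bounded_linear_fst bounded_linear_snd)

text \<open>The differential of F is the sum of its partial differentials, each represented by a
  vector; the pair of these vectors represents the sum.\<close>

lemma functional_derivative_dual_split:
  fixes F :: "('a::real_normed_vector \<Rightarrow>\<^sub>L real) \<times> ('b::real_normed_vector \<Rightarrow>\<^sub>L real) \<Rightarrow> real"
  assumes A: "finite (A :: 'a set)" "span A = UNIV" and B: "finite (B :: 'b set)" "span B = UNIV"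
    and F: "F differentiable (at (\<mu>, \<nu>))"
  shows "functional_derivative (F \<circ> dual_split) (dual_pair (\<mu>, \<nu>)) =
    (functional_derivative (\<lambda>\<mu>'. F (\<mu>', \<nu>)) \<mu>, functional_derivative (\<lambda>\<nu>'. F (\<mu>, \<nu>')) \<nu>)"
proof (rule functional_derivative_eqI[OF span_Times_finite[OF A B]])
  let ?D = "frechet_derivative F (at (\<mu>, \<nu>))"
  have D: "(F has_derivative ?D) (at (\<mu>, \<nu>))" using F frechet_derivative_works by blast
  show "(F \<circ> dual_split has_derivative (\<lambda>\<beta>. ?D (dual_split \<beta>))) (at (dual_pair (\<mu>, \<nu>)))"
    using has_derivative_compose[OF bounded_linear_imp_has_derivative[OF bounded_linear_dual_split], of F]
      D by (simp add: o_def dual_split_dual_pair)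
  have 1: "((\<lambda>\<mu>'. F (\<mu>', \<nu>)) has_derivative (\<lambda>\<beta>. ?D (\<beta>, 0))) (at \<mu>)"
    by (rule has_derivative_compose[of "\<lambda>\<mu>'. (\<mu>', \<nu>)" "\<lambda>\<beta>. (\<beta>, 0)" \<mu> UNIV F])
      (auto intro!: derivative_eq_intros D)
  have 2: "((\<lambda>\<nu>'. F (\<mu>, \<nu>')) has_derivative (\<lambda>\<beta>. ?D (0, \<beta>))) (at \<nu>)"
    by (rule has_derivative_compose[of "\<lambda>\<nu>'. (\<mu>, \<nu>')" "\<lambda>\<beta>. (0, \<beta>)" \<nu> UNIV F])
      (auto intro!: derivative_eq_intros D)
  fix \<beta> :: "('a \<times> 'b) \<Rightarrow>\<^sub>L real"
  obtain \<beta>1 \<beta>2 where \<beta>: "dual_split \<beta> = (\<beta>1, \<beta>2)" by force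
  have "?D (dual_split \<beta>) = ?D (\<beta>1, 0) + ?D (0, \<beta>2)"
    using linear_add[OF has_derivative_linear[OF D], of "(\<beta>1, 0)" "(0, \<beta>2)"] by (simp add: \<beta>)
  also have "?D (\<beta>1, 0) = blinfun_apply \<beta>1 (functional_derivative (\<lambda>\<mu>'. F (\<mu>', \<nu>)) \<mu>)"
    using functional_derivative[OF A differentiableI[OF 1], of \<beta>1] by (simp flip: frechet_derivative_at[OF 1])
  also have "?D (0, \<beta>2) = blinfun_apply \<beta>2 (functional_derivative (\<lambda>\<nu>'. F (\<mu>, \<nu>')) \<nu>)"
    using functional_derivative[OF B differentiableI[OF 2], of \<beta>2] by (simp flip: frechet_derivative_at[OF 2])
  finally show "?D (dual_split \<beta>) = blinfun_apply \<beta> (functional_derivative (\<lambda>\<mu>'. F (\<mu>', \<nu>)) \<mu>,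
      functional_derivative (\<lambda>\<nu>'. F (\<mu>, \<nu>')) \<nu>)"
    using dual_pair_apply[of \<beta>1 \<beta>2] dual_pair_dual_split[of \<beta>] by (simp add: \<beta>)
qed

section \<open>Hamiltonian vector fields\<close>

lemma smooth_on_const: "smooth_on S (\<lambda>_. a)"
proof -
  have "Ck_on k (\<lambda>_. a) S" for k and a :: 'b
    by (induction k arbitrary: a) (auto simp: frechet_derivative_const)
  then show ?thesis unfolding smooth_on_def by blast
qed

lemma smooth_on_bounded_linear:
  assumes "bounded_linear f" shows "smooth_on S f"
proof -
  have const: "Ck_on k (\<lambda>_. f v) S" for k v
    using smooth_on_const[of S "f v"] unfolding smooth_on_def by blast
  have "frechet_derivative f (at x) = f" for x
    using frechet_derivative_at[OF bounded_linear_imp_has_derivative[OF assms]] by metis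
  then have "Ck_on (Suc k) f S" for k
    using const bounded_linear_imp_differentiable[OF assms] by simp
  moreover have "Ck_on 0 f S" using assms by (simp add: linear_continuous_on)
  ultimately show ?thesis unfolding smooth_on_def by (metis not0_implies_Suc)
qed

text \<open>\<open>Blinfun\<close> is meaningful only on bounded linear maps; finite dimension turns
  linearity of the bracket into boundedness.\<close>

lemma ad_star_apply:
  fixes B :: "'k::real_normed_vector set" and br :: "'k \<Rightarrow> 'k \<Rightarrow> 'k"
  assumes B: "finite B" "span B = UNIV" and lin: "linear (br \<xi>)"
  shows "blinfun_apply (ad_star br \<xi> \<mu>) \<eta> = blinfun_apply \<mu> (br \<xi> \<eta>)"
proof -
  have "bounded_linear (\<lambda>\<eta>. blinfun_apply \<mu> (br \<xi> \<eta>))"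
    by (rule bounded_linear_compose[OF blinfun.bounded_linear_right
          linear_imp_bounded_linear_finite_span[OF B lin]])
  then show ?thesis by (simp add: ad_star_def bounded_linear_Blinfun_apply)
qed

text \<open>Evaluation at a vector \<eta> is a smooth function on the dual with constant functional
  derivative \<eta>, and testing against all evaluations determines X. Antisymmetry absorbs the
  minus sign of the definition.\<close>

lemma hamiltonian_vector_field_iff:
  fixes B :: "'k::real_normed_vector set" and br :: "'k \<Rightarrow> 'k \<Rightarrow> 'k"
  assumes B: "finite B" "span B = UNIV" and lin: "\<And>\<xi>. linear (br \<xi>)"
    and antisym: "\<And>\<xi> \<eta>. br \<xi> \<eta> = - br \<eta> \<xi>"
  shows "hamiltonian_vector_field br H X \<longleftrightarrow> X = (\<lambda>\<alpha>. ad_star br (functional_derivative H \<alpha>) \<alpha>)"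
proof
  assume X: "hamiltonian_vector_field br H X"
  show "X = (\<lambda>\<alpha>. ad_star br (functional_derivative H \<alpha>) \<alpha>)"
  proof (intro ext blinfun_eqI)
    fix \<alpha> \<eta>
    let ?F = "\<lambda>\<beta> :: 'k \<Rightarrow>\<^sub>L real. blinfun_apply \<beta> \<eta>"
    have bl: "bounded_linear ?F" by (rule blinfun.bounded_linear_left)
    note der = bounded_linear_imp_has_derivative[OF bl]
    have "functional_derivative ?F \<alpha> = \<eta>" by (rule functional_derivative_eqI[OF B der refl])
    moreover have "frechet_derivative ?F (at \<alpha>) = ?F" using frechet_derivative_at[OF der] by metis
    ultimately have "blinfun_apply \<alpha> (br \<eta> (functional_derivative H \<alpha>)) = - blinfun_apply (X \<alpha>) \<eta>"
      using X smooth_on_bounded_linear[OF bl] unfolding hamiltonian_vector_field_def lie_poisson_def by metis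
    then show "blinfun_apply (X \<alpha>) \<eta> = blinfun_apply (ad_star br (functional_derivative H \<alpha>) \<alpha>) \<eta>"
      by (subst (asm) antisym) (simp add: ad_star_apply[OF B lin] blinfun.minus_right)
  qed
next
  assume X: "X = (\<lambda>\<alpha>. ad_star br (functional_derivative H \<alpha>) \<alpha>)"
  show "hamiltonian_vector_field br H X"
    unfolding hamiltonian_vector_field_def lie_poisson_def
  proof (intro allI impI)
    fix F :: "('k \<Rightarrow>\<^sub>L real) \<Rightarrow> real" and \<alpha> assume "smooth_on UNIV F"
    then have "F differentiable (at \<alpha>)" by (rule smooth_on_differentiable) simp
    from functional_derivative[OF B this]
    show "blinfun_apply \<alpha> (br (functional_derivative F \<alpha>) (functional_derivative H \<alpha>)) =
        - frechet_derivative F (at \<alpha>) (X \<alpha>)"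
      by (subst antisym) (simp add: X ad_star_apply[OF B lin] blinfun.minus_right)
  qed
qed

section \<open>The Lie-Poisson structure of the semidirect product\<close>

context lie_group_chart
begin

lemma linear_lie_bracket: "linear (lie_bracket G c \<xi>)"
  using linear_\<beta>2 by (simp add: lie_bracket_eq[abs_def])

lemma lie_bracket_antisym: "lie_bracket G c \<xi> \<eta> = - lie_bracket G c \<eta> \<xi>"
  unfolding lie_bracket_eq by (rule \<beta>_antisym)

lemma linear_lie_bracket_SD: "linear (lie_bracket SD sc \<alpha>)"
proof -
  obtain \<xi> \<xi>' where \<alpha>: "\<alpha> = (\<xi>, \<xi>')" by force
  have l1: "linear (\<lambda>\<eta>. lie_bracket G c \<eta> \<xi>')"
    using linear_\<beta>1 by (simp add: lie_bracket_eq)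
  show ?thesis unfolding \<alpha>
    by (rule linearI; clarify)
      (simp_all add: lie_bracket_SD linear_add[OF linear_lie_bracket] linear_add[OF l1]
        linear_scale[OF linear_lie_bracket] linear_scale[OF l1] scaleR_diff_right)
qed

lemma lie_bracket_SD_antisym: "lie_bracket SD sc \<alpha> \<alpha>' = - lie_bracket SD sc \<alpha>' \<alpha>"
proof -
  obtain \<xi> \<xi>' \<eta> \<eta>' where "\<alpha> = (\<xi>, \<xi>')" "\<alpha>' = (\<eta>, \<eta>')" by force
  then show ?thesis
    using lie_bracket_antisym[of \<xi> \<eta>] by (simp add: lie_bracket_SD)
qed

text \<open>In the pairing with \<open>(\<eta>, \<eta>')\<close>, antisymmetry turns the term
  \<open>- [\<eta>, \<xi>']\<close> under \<nu> into \<open>[\<xi>', \<eta>]\<close>; it is linear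
  in \<eta> and therefore belongs to the first component.\<close>

lemma ad_star_SD:
  "ad_star (lie_bracket SD sc) (\<xi>, \<xi>') (dual_pair (\<mu>, \<nu>)) =
     dual_pair (ad_star (lie_bracket G c) \<xi> \<mu> + ad_star (lie_bracket G c) \<xi>' \<nu>, ad_star (lie_bracket G c) \<xi> \<nu>)"
proof -
  obtain B :: "'e set" where B: "finite B" "span B = UNIV" by (rule finite_span)
  note ad = ad_star_apply[OF B linear_lie_bracket]
    ad_star_apply[OF span_Times_finite[OF B B] linear_lie_bracket_SD]
  show ?thesis
  proof (rule blinfun_eqI, clarify)
    fix \<eta> \<eta>'
    show "blinfun_apply (ad_star (lie_bracket SD sc) (\<xi>, \<xi>') (dual_pair (\<mu>, \<nu>))) (\<eta>, \<eta>') =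
        blinfun_apply (dual_pair (ad_star (lie_bracket G c) \<xi> \<mu> + ad_star (lie_bracket G c) \<xi>' \<nu>,
          ad_star (lie_bracket G c) \<xi> \<nu>)) (\<eta>, \<eta>')"
      using lie_bracket_antisym[of \<eta> \<xi>']
      by (simp add: ad dual_pair_apply lie_bracket_SD blinfun.add_left blinfun.add_right)
  qed
qed

end

text \<open>\<open>dual_split\<close> and \<open>dual_pair\<close> are mutually inverse bounded
  linear maps, so derivatives of curves pass through them in both directions.\<close>

lemma has_vector_derivative_dual_pair_iff:
  "((\<lambda>t. dual_pair (\<mu> t, \<nu> t)) has_vector_derivative dual_pair (a, b)) (at t) \<longleftrightarrow>
     (\<mu> has_vector_derivative a) (at t) \<and> (\<nu> has_vector_derivative b) (at t)" (is "?L \<longleftrightarrow> ?R")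
proof
  assume ?L
  from bounded_linear.has_vector_derivative[OF bounded_linear_dual_split this]
  have *: "((\<lambda>t. (\<mu> t, \<nu> t)) has_vector_derivative (a, b)) (at t)" by (simp add: dual_split_dual_pair)
  from bounded_linear.has_vector_derivative[OF bounded_linear_fst *]
    bounded_linear.has_vector_derivative[OF bounded_linear_snd *]
  show ?R by simp
next
  assume ?R
  then show ?L
    by (intro bounded_linear.has_vector_derivative[OF bounded_linear_dual_pair] has_vector_derivative_Pair) auto
qed

theorem mainTheorem8:
  fixes G :: "('g, 'e::banach) lie_grp" and c :: "('g, 'e) chart"
  assumes "lie_group G" and "chart_at_one G c"
  defines "br \<equiv> lie_bracket G c"
    and "sbr \<equiv> lie_bracket (semidirect G c) (semidirect_chart c)"
  shows "(\<forall>(F :: ('e \<Rightarrow>\<^sub>L real) \<times> ('e \<Rightarrow>\<^sub>L real) \<Rightarrow> real) K \<mu> \<nu>.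
      smooth_on UNIV F \<and> smooth_on UNIV K \<longrightarrow>
      (let F\<mu> = functional_derivative (\<lambda>\<mu>'. F (\<mu>', \<nu>)) \<mu>;
           F\<nu> = functional_derivative (\<lambda>\<nu>'. F (\<mu>, \<nu>')) \<nu>;
           K\<mu> = functional_derivative (\<lambda>\<mu>'. K (\<mu>', \<nu>)) \<mu>;
           K\<nu> = functional_derivative (\<lambda>\<nu>'. K (\<mu>, \<nu>')) \<nu>
       in lie_poisson sbr (F \<circ> dual_split) (K \<circ> dual_split) (dual_pair (\<mu>, \<nu>)) =
          blinfun_apply \<mu> (br F\<mu> K\<mu>) + blinfun_apply \<nu> (br F\<mu> K\<nu> - br K\<mu> F\<nu>)))
    \<and> (\<forall>H :: ('e \<Rightarrow>\<^sub>L real) \<times> ('e \<Rightarrow>\<^sub>L real) \<Rightarrow> real. smooth_on UNIV H \<longrightarrow>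
      (\<exists>!X. hamiltonian_vector_field sbr (H \<circ> dual_split) X) \<and>
      (\<forall>X T \<mu> \<nu>. hamiltonian_vector_field sbr (H \<circ> dual_split) X \<and> open T \<and> is_interval T \<longrightarrow>
        (integral_curve X T (\<lambda>t. dual_pair (\<mu> t, \<nu> t)) \<longleftrightarrow>
         (\<forall>t\<in>T.
           let H\<mu> = functional_derivative (\<lambda>\<mu>'. H (\<mu>', \<nu> t)) (\<mu> t);
               H\<nu> = functional_derivative (\<lambda>\<nu>'. H (\<mu> t, \<nu>')) (\<nu> t)
           in (\<mu> has_vector_derivative ad_star br H\<mu> (\<mu> t) + ad_star br H\<nu> (\<nu> t)) (at t) \<and>
              (\<nu> has_vector_derivative ad_star br H\<mu> (\<nu> t)) (at t)))))"
proof -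
  interpret lie_group_chart G c using assms(1,2) by unfold_locales
  obtain B :: "'e set" where B: "finite B" "span B = UNIV" by (rule finite_span)
  have fd: "functional_derivative (F \<circ> dual_split) (dual_pair (\<mu>, \<nu>)) =
      (functional_derivative (\<lambda>\<mu>'. F (\<mu>', \<nu>)) \<mu>, functional_derivative (\<lambda>\<nu>'. F (\<mu>, \<nu>')) \<nu>)"
    if "smooth_on UNIV F" for F :: "('e \<Rightarrow>\<^sub>L real) \<times> ('e \<Rightarrow>\<^sub>L real) \<Rightarrow> real" and \<mu> \<nu>
    by (rule functional_derivative_dual_split[OF B B smooth_on_differentiable[OF that UNIV_I]])
  \<comment> \<open>With X explicit, existence and uniqueness are immediate, and Hamilton's
    equations are the two components of this formula given by \<open>ad_star_SD\<close>.\<close>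
  have ham: "hamiltonian_vector_field sbr H X \<longleftrightarrow> X = (\<lambda>\<alpha>. ad_star sbr (functional_derivative H \<alpha>) \<alpha>)" for H X
    unfolding sbr_def
    by (rule hamiltonian_vector_field_iff[OF span_Times_finite[OF B B] linear_lie_bracket_SD lie_bracket_SD_antisym])
  show ?thesis
  proof (intro conjI allI impI)
    fix F K :: "('e \<Rightarrow>\<^sub>L real) \<times> ('e \<Rightarrow>\<^sub>L real) \<Rightarrow> real" and \<mu> \<nu>
    assume "smooth_on UNIV F \<and> smooth_on UNIV K"
    then show "let F\<mu> = functional_derivative (\<lambda>\<mu>'. F (\<mu>', \<nu>)) \<mu>;
           F\<nu> = functional_derivative (\<lambda>\<nu>'. F (\<mu>, \<nu>')) \<nu>;
           K\<mu> = functional_derivative (\<lambda>\<mu>'. K (\<mu>', \<nu>)) \<mu>;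
           K\<nu> = functional_derivative (\<lambda>\<nu>'. K (\<mu>, \<nu>')) \<nu>
       in lie_poisson sbr (F \<circ> dual_split) (K \<circ> dual_split) (dual_pair (\<mu>, \<nu>)) =
          blinfun_apply \<mu> (br F\<mu> K\<mu>) + blinfun_apply \<nu> (br F\<mu> K\<nu> - br K\<mu> F\<nu>)"
      unfolding Let_def lie_poisson_def
      by (simp add: fd sbr_def br_def lie_bracket_SD dual_pair_apply)
  next
    fix H :: "('e \<Rightarrow>\<^sub>L real) \<times> ('e \<Rightarrow>\<^sub>L real) \<Rightarrow> real"
    show "\<exists>!X. hamiltonian_vector_field sbr (H \<circ> dual_split) X" unfolding ham by blast
  next
    fix H :: "('e \<Rightarrow>\<^sub>L real) \<times> ('e \<Rightarrow>\<^sub>L real) \<Rightarrow> real" and X and T :: "real set" and \<mu> \<nu>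
    assume H: "smooth_on UNIV H"
      and "hamiltonian_vector_field sbr (H \<circ> dual_split) X \<and> open T \<and> is_interval T"
    then have X: "X = (\<lambda>\<alpha>. ad_star sbr (functional_derivative (H \<circ> dual_split) \<alpha>) \<alpha>)" using ham by blast
    show "integral_curve X T (\<lambda>t. dual_pair (\<mu> t, \<nu> t)) \<longleftrightarrow>
         (\<forall>t\<in>T.
           let H\<mu> = functional_derivative (\<lambda>\<mu>'. H (\<mu>', \<nu> t)) (\<mu> t);
               H\<nu> = functional_derivative (\<lambda>\<nu>'. H (\<mu> t, \<nu>')) (\<nu> t)
           in (\<mu> has_vector_derivative ad_star br H\<mu> (\<mu> t) + ad_star br H\<nu> (\<nu> t)) (at t) \<and>
              (\<nu> has_vector_derivative ad_star br H\<mu> (\<nu> t)) (at t))"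
      unfolding integral_curve_def X Let_def
      by (simp add: fd[OF H] sbr_def br_def ad_star_SD has_vector_derivative_dual_pair_iff)
  qed
qed

end
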